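(* There is a partial computable function $f:\subseteq\{0,1\}^\omega\to\{0,1\}^\omega$ which is injective on its domain and left-oneway, i.e. $\mu(\mathrm{dom}(f))>0$ and for every partial computable $g:\subseteq\{0,1\}^\omega\to\{0,1\}^\omega$, $$\mu\big(\{x\oplus r: f(g(f(x)\oplus r))=f(x)\}\big)=0.$$
   Context: Reals are elements of $\{0,1\}^\omega$ (infinite binary sequences) and $\mu$ is the uniform measure on $\{0,1\}^\omega$. For reals $x,y$, $x\oplus y$ is the real $z$ with $z(2n)=x(n)$, $z(2n+1)=y(n)$. $f:\subseteq\{0,1\}^\omega\to\{0,1\}^\omega$ denotes a partial function with nonempty domain $\mathrm{dom}(f)\subseteq\{0,1\}^\omega$. It is partial computable if there is an oracle Turing functional $\Phi$ such that for every $x$: $x\in\mathrm{dom}(f)$ iff $\Phi^x(n)\downarrow$ for all $n$; and if $x\in\mathrm{dom}(f)$ then $\Phi^x(n)=f(x)(n)$ for all $n$. An equation such as $f(g(f(x)\oplus r))=f(x)$ includes the assertion that all terms are defined. *)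

theory Defs
  imports "HOL-Probability.Probability"
begin

type_synonym cantor = "nat \<Rightarrow> bool"

definition cantor_measure :: "cantor measure" where
  "cantor_measure = (\<Pi>\<^sub>M i\<in>UNIV. uniform_count_measure (UNIV :: bool set))"

definition join :: "cantor \<Rightarrow> cantor \<Rightarrow> cantor" (infixl "\<squnion>\<squnion>" 65) where
  "x \<squnion>\<squnion> y = (\<lambda>n. if even n then x (n div 2) else y (n div 2))"

lemma join_even_odd: "(x \<squnion>\<squnion> y) (2 * n) = x n" "(x \<squnion>\<squnion> y) (2 * n + 1) = y n"
  by (simp_all add: join_def)

text \<open>
  Turing functionals are given by Kleene's schemes for partial recursive functions, extended by
  a scheme \<open>Query\<close> that reads a bit of the oracle. A program of this syntax is a finite object
  that does not depend on the oracle, so the computation is uniform in the oracle.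
\<close>

datatype functional =
    Zero
  | Succ
  | Proj nat
  | Query
  | Comp functional "functional list"
  | PrimRec functional functional
  | Mu functional

text \<open>
  \<open>computes x e ns v\<close>: the program \<open>e\<close> with oracle \<open>x\<close> halts on the arguments \<open>ns\<close> with value \<open>v\<close>.
  Divergence is the absence of such a \<open>v\<close>; a program applied to a number of arguments that does
  not fit its outermost scheme diverges.
\<close>

inductive computes :: "cantor \<Rightarrow> functional \<Rightarrow> nat list \<Rightarrow> nat \<Rightarrow> bool" for x :: cantor where
  zero: "computes x Zero ns 0"
| succ: "computes x Succ [n] (Suc n)"
| proj: "i < length ns \<Longrightarrow> computes x (Proj i) ns (ns ! i)"
| query: "computes x Query [n] (of_bool (x n))"
| comp: "list_all2 (\<lambda>g m. computes x g ns m) gs ms \<Longrightarrow> computes x f ms v \<Longrightarrow>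
    computes x (Comp f gs) ns v"
| rec_0: "computes x f ns v \<Longrightarrow> computes x (PrimRec f g) (0 # ns) v"
| rec_Suc: "computes x (PrimRec f g) (k # ns) u \<Longrightarrow> computes x g (k # u # ns) v \<Longrightarrow>
    computes x (PrimRec f g) (Suc k # ns) v"
| mu: "computes x f (k # ns) 0 \<Longrightarrow> (\<forall>i<k. \<exists>u. computes x f (i # ns) (Suc u)) \<Longrightarrow>
    computes x (Mu f) ns k"

inductive_cases computes_ZeroE: "computes x Zero ns v"
inductive_cases computes_SuccE: "computes x Succ ns v"
inductive_cases computes_ProjE: "computes x (Proj i) ns v"
inductive_cases computes_QueryE: "computes x Query ns v"
inductive_cases computes_CompE: "computes x (Comp f gs) ns v"
inductive_cases computes_PrimRec_0E: "computes x (PrimRec f g) (0 # ns) v"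
inductive_cases computes_PrimRec_SucE: "computes x (PrimRec f g) (Suc k # ns) v"
inductive_cases computes_MuE: "computes x (Mu f) ns v"

lemma computes_unique: "computes x e ns v \<Longrightarrow> computes x e ns w \<Longrightarrow> v = w"
proof (induction arbitrary: w rule: computes.induct)
  case (zero ns)
  then show ?case by (rule computes_ZeroE) simp
next
  case (succ n)
  then show ?case by (rule computes_SuccE) simp
next
  case (proj i ns)
  from proj(2) show ?case by (rule computes_ProjE) simp
next
  case (query n)
  then show ?case by (rule computes_QueryE) simp
next
  case (comp ns gs ms f v)
  from comp.prems obtain ms' where ms': "list_all2 (\<lambda>g m. computes x g ns m) gs ms'"
    and w: "computes x f ms' w"
    by (rule computes_CompE)
  have "ms = ms'"
  proof (rule nth_equalityI)
    show "length ms = length ms'"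
      using comp.IH(1) ms' by (simp add: list_all2_conv_all_nth)
  next
    fix i assume "i < length ms"
    then show "ms ! i = ms' ! i"
      using comp.IH(1) ms' by (simp add: list_all2_conv_all_nth)
  qed
  then show ?case using comp.IH(2) w by blast
next
  case (rec_0 f ns v g)
  from rec_0.prems have "computes x f ns w" by (rule computes_PrimRec_0E)
  then show ?case by (rule rec_0.IH)
next
  case (rec_Suc f g k ns u v)
  from rec_Suc.prems obtain u' where "computes x (PrimRec f g) (k # ns) u'"
    and "computes x g (k # u' # ns) w"
    by (rule computes_PrimRec_SucE)
  then show ?case using rec_Suc.IH by blast
next
  case (mu f k ns)
  from mu.prems have *: "computes x f (w # ns) 0 \<and> (\<forall>i<w. \<exists>u. computes x f (i # ns) (Suc u))"
    by (rule computes_MuE) (rule conjI)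
  show ?case
  proof (rule linorder_cases[of k w])
    assume "k < w"
    with * obtain u where "computes x f (k # ns) (Suc u)" by blast
    then have "0 = Suc u" by (rule mu.IH(1))
    then show ?thesis by simp
  next
    assume "w < k"
    with mu.IH(2) obtain u where "\<forall>a. computes x f (w # ns) a \<longrightarrow> Suc u = a" by blast
    with * have "Suc u = 0" by blast
    then show ?thesis by simp
  qed
qed

text \<open>
  A partial function has nonempty domain by convention. The domain is required to be exactly the
  set of oracles for which the functional is total; values are identified with bits by \<open>of_bool\<close>.
\<close>

definition partial_computable :: "(cantor \<rightharpoonup> cantor) \<Rightarrow> bool" where
  "partial_computable f \<longleftrightarrow> dom f \<noteq> {} \<and>
    (\<exists>\<Phi>. \<forall>x. (x \<in> dom f \<longleftrightarrow> (\<forall>n. \<exists>v. computes x \<Phi> [n] v)) \<and>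
              (x \<in> dom f \<longrightarrow> (\<forall>n. computes x \<Phi> [n] (of_bool (the (f x) n)))))"

text \<open>
  The equation \<open>f (g (f x \<squnion>\<squnion> r)) = f x\<close> includes that all its terms are defined. Membership in
  \<open>null_sets\<close> includes measurability, so that the null condition is not met vacuously through
  \<open>measure\<close> being 0 on non-measurable sets.
\<close>

definition left_oneway :: "(cantor \<rightharpoonup> cantor) \<Rightarrow> bool" where
  "left_oneway f \<longleftrightarrow> emeasure cantor_measure (dom f) > 0 \<and>
    (\<forall>g. partial_computable g \<longrightarrow>
      {x \<squnion>\<squnion> r | x r. \<exists>y z. f x = Some y \<and> g (y \<squnion>\<squnion> r) = Some z \<and> f z = Some y}
        \<in> null_sets cantor_measure)"

end

theory Submission
  imports Defs "HOL-Library.Nat_Bijection"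
begin

text \<open>
The function is a total computable map \<open>encrypt\<close> restricted to a set \<open>settled\<close> on which it is
injective. If the domain were effectively closed, compactness would make the inverse computable.
It is only an effective countable intersection of open sets, and membership in it tells, in the limit,
what no algorithm can read off the output.

A real is cut into columns, one for each pair \<open>(k, s)\<close> of a requirement and a stage. Requirement
\<open>k\<close> names a program \<open>\<Phi>\<close> and a cylinder of reals \<open>r\<close>, and asks that \<open>\<Phi>\<close> does not recover \<open>x\<close> from
\<open>encrypt x \<squnion>\<squnion> r\<close> for more than half of the \<open>r\<close> in the cylinder. Meeting all requirements for almost
every \<open>x\<close> in the domain is enough: if \<open>\<Phi>\<close> recovered \<open>x\<close> for a set of \<open>r\<close> of positive measure, this
set would fill more than half of some cylinder (\<open>dense_cylinder\<close>), and Fubini's theorem along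
\<open>(x, r) \<mapsto> x \<squnion>\<squnion> r\<close> (\<open>distr_join\<close>) passes from null sections to the null set of the theorem.

Requirement \<open>k\<close> makes a sequence of attempts, each with a fresh column. The column waits if it
begins with \<open>k + 2\<close> ones and then a zero. The output shows a waiting column without its leading
ones, so its first bit is shown wrongly, and any other column as it is. The attempt fires once more
than half of the cylinder is seen to make \<open>\<Phi>\<close> answer with the shown first bit. If a waiting column
fires, this majority is wrong about \<open>x\<close>. If a column that does not wait never fires, no majority is
right about \<open>x\<close>. If a column that does not wait fires, \<open>k\<close> starts its next attempt. The reals with a
waiting column that never fires are thrown out of the domain. This makes \<open>encrypt\<close> injective
(\<open>inj_on_encrypt\<close>): a column that never fires is shown as it is, and after a firing the output carries
a marker bit that tells whether the column waited.

Two estimates complete the proof. Deleting the leading ones of a waiting column that never fires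
does not change the output (\<open>encrypt_skip\<close>), so what \<open>k\<close> throws out has at most \<open>2 ^ -(k + 2)\<close> times the
measure of the reals for which the last attempt of \<open>k\<close> never fires; altogether at most half of the
space is lost (\<open>emeasure_settled\<close>). And the column of an attempt is independent of everything that
led to it and waits with probability \<open>2 ^ -(k + 3)\<close>, so if all attempts of \<open>k\<close> fire, almost surely one of
their columns waits (\<open>AE_waits\<close>).

That \<open>encrypt\<close> is computable needs a universal procedure for all programs. It searches for finite
certificates, lists of statements ``program \<open>\<Phi>\<close> returns \<open>v\<close> on \<open>ns\<close>'' each of which follows by one of
the schemes from statements further down the list (\<open>computes_iff_says\<close>). Checking a certificate takes
only bounded quantifiers over coded pairs and lists.
\<close>

section \<open>Total computable functions\<close>

text \<open>
Functions of several variables are treated as functions of one variable that holds a tuple of nested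
pairs. The closure rules below then match the shape of a term, and a bound variable of a quantifier,
sum or recursion is a projection of the extended tuple.
\<close>

definition computable :: "(cantor \<Rightarrow> nat \<Rightarrow> nat) \<Rightarrow> bool" where
  "computable F \<longleftrightarrow> (\<exists>\<Phi>. \<forall>x n. computes x \<Phi> [n] (F x n))"

definition decidable :: "(cantor \<Rightarrow> nat \<Rightarrow> bool) \<Rightarrow> bool" where
  "decidable P \<longleftrightarrow> computable (\<lambda>x n. of_bool (P x n))"

definition pfst :: "nat \<Rightarrow> nat" where "pfst n = fst (prod_decode n)"
definition psnd :: "nat \<Rightarrow> nat" where "psnd n = snd (prod_decode n)"

lemma pfst_prod_encode [simp]: "pfst (prod_encode (a, b)) = a"
  and psnd_prod_encode [simp]: "psnd (prod_encode (a, b)) = b"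
  by (simp_all add: pfst_def psnd_def)

lemma prod_encode_pfst_psnd [simp]: "prod_encode (pfst n, psnd n) = n"
  by (simp add: pfst_def psnd_def)

lemma computes_Comp1:
  "computes x g ns m \<Longrightarrow> computes x f [m] v \<Longrightarrow> computes x (Comp f [g]) ns v"
  by (rule computes.comp[where ms="[m]"]) auto

lemma computes_Succ_Comp: "computes x g ns m \<Longrightarrow> computes x (Comp Succ [g]) ns (Suc m)"
  by (rule computes_Comp1[OF _ computes.succ])

lemma computes_Comp2:
  "computes x g ns m \<Longrightarrow> computes x h ns n \<Longrightarrow> computes x f [m, n] v \<Longrightarrow>
    computes x (Comp f [g, h]) ns v"
  by (rule computes.comp[where ms="[m, n]"]) auto

lemma computes_Proj: "i < length ns \<Longrightarrow> v = ns ! i \<Longrightarrow> computes x (Proj i) ns v"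
  using computes.proj by blast

lemma computes_PrimRec:
  assumes "computes x f ns (h 0)" "\<And>i. computes x g (i # h i # ns) (h (Suc i))"
  shows "computes x (PrimRec f g) (m # ns) (h m)"
  using assms by (induction m) (auto intro: computes.intros)

lemma computableI: "(\<And>x n. computes x \<Phi> [n] (F x n)) \<Longrightarrow> computable F"
  unfolding computable_def by blast

lemma computableE:
  assumes "computable F" obtains \<Phi> where "\<And>x n. computes x \<Phi> [n] (F x n)"
  using assms unfolding computable_def by blast

lemma computable_id: "computable (\<lambda>x n. n)"
  by (rule computableI[where \<Phi>="Proj 0"]) (simp add: computes_Proj)

lemma computable_compose:
  assumes "computable G" "computable F"
  shows "computable (\<lambda>x n. G x (F x n))"
proof -
  obtain \<Phi> \<Psi> where "computes x \<Phi> [n] (G x n)" "computes x \<Psi> [n] (F x n)" for x n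
    using assms by (meson computableE)
  then show ?thesis
    by (intro computableI[where \<Phi>="Comp \<Phi> [\<Psi>]"]) (rule computes_Comp1)
qed

lemma computable_Suc:
  assumes "computable F" shows "computable (\<lambda>x n. Suc (F x n))"
  using assms by (elim computableE) (rule computableI, rule computes_Succ_Comp)

lemma computable_const: "computable (\<lambda>x n. c)"
proof (induction c)
  case 0
  show ?case
    by (rule computableI[where \<Phi>=Zero]) (rule computes.zero)
qed (rule computable_Suc)

text \<open>
Two-place programs serve only to build the pairing function; afterwards pairs replace them.
\<close>

definition computable2 :: "(nat \<Rightarrow> nat \<Rightarrow> nat) \<Rightarrow> bool" where
  "computable2 H \<longleftrightarrow> (\<exists>\<Phi>. \<forall>x m n. computes x \<Phi> [m, n] (H m n))"

lemma computable2D: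
  assumes "computable2 H" "computable F" "computable G"
  shows "computable (\<lambda>x n. H (F x n) (G x n))"
proof -
  obtain \<Phi> \<Psi> where "computes x \<Phi> [n] (F x n)" "computes x \<Psi> [n] (G x n)" for x n
    using assms(2,3) by (meson computableE)
  moreover obtain \<Theta> where "computes x \<Theta> [m, n] (H m n)" for x m n
    using assms(1) unfolding computable2_def by blast
  ultimately show ?thesis
    by (intro computableI[where \<Phi>="Comp \<Theta> [\<Phi>, \<Psi>]"]) (rule computes_Comp2)
qed

lemma computable_oracle:
  assumes "computable F"
  shows "decidable (\<lambda>x n. x (F x n))"
proof -
  have "computable (\<lambda>x n. of_bool (x n))"
    by (rule computableI) (rule computes.query)
  from computable_compose[OF this assms] show ?thesis
    by (simp add: decidable_def)
qed

lemma computes_add: "computes x (PrimRec (Proj 0) (Comp Succ [Proj 1])) [m, n] (m + n)"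
proof (rule computes_PrimRec[where h="\<lambda>m. m + n"])
  show "computes x (Comp Succ [Proj 1]) [i, i + n, n] (Suc i + n)" for i
    using computes_Succ_Comp[OF computes.proj[of 1 "[i, i + n, n]"]] by simp
qed (simp add: computes_Proj)

lemma computable2_add: "computable2 (+)"
  unfolding computable2_def using computes_add by blast

lemma computes_pred: "computes x (PrimRec Zero (Proj 0)) [n] (n - 1)"
  by (rule computes_PrimRec[where h="\<lambda>n. n - 1"]) (simp_all add: computes_Proj computes.zero)

lemma computable2_minus: "computable2 (-)"
proof -
  let ?P = "Comp (PrimRec Zero (Proj 0)) [Proj 1]"
  have step: "computes x ?P [i, n - i, n] (n - Suc i)" for x i n
  proof (rule computes_Comp1)
    show "computes x (Proj 1) [i, n - i, n] (n - i)"
      by (rule computes_Proj) auto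
    show "computes x (PrimRec Zero (Proj 0)) [n - i] (n - Suc i)"
      using computes_pred[of x "n - i"] by simp
  qed
  have "computes x (PrimRec (Proj 0) ?P) [m, n] (n - m)" for x m n
    by (rule computes_PrimRec[where h="\<lambda>m. n - m"]) (simp_all only: step, simp add: computes_Proj)
  then have "computes x (Comp (PrimRec (Proj 0) ?P) [Proj 1, Proj 0]) [n, m] (n - m)" for x m n
    by (rule computes_Comp2[rotated 2]) (simp_all add: computes_Proj)
  then show ?thesis
    unfolding computable2_def by blast
qed

lemma computable2_mult: "computable2 (*)"
proof -
  have "computes x (PrimRec Zero (Comp (PrimRec (Proj 0) (Comp Succ [Proj 1])) [Proj 2, Proj 1]))
     [m, n] (m * n)" for x m n
  proof (rule computes_PrimRec[where h="\<lambda>m. m * n"])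
    show "computes x (Comp (PrimRec (Proj 0) (Comp Succ [Proj 1])) [Proj 2, Proj 1])
      [i, i * n, n] (Suc i * n)" for i
      using computes_Comp2[OF computes_Proj computes_Proj computes_add,
          of 2 "[i, i * n, n]" n 1 "i * n" x] by simp
  qed (simp add: computes.zero)
  then show ?thesis
    unfolding computable2_def by blast
qed

lemmas computable_add = computable2D[OF computable2_add]
lemmas computable_minus = computable2D[OF computable2_minus]
lemmas computable_mult = computable2D[OF computable2_mult]

lemma computable_triangle:
  assumes "computable F"
  shows "computable (\<lambda>x n. triangle (F x n))"
proof -
  have "computes x (PrimRec Zero (Comp (PrimRec (Proj 0) (Comp Succ [Proj 1]))
      [Proj 1, Comp Succ [Proj 0]])) [n] (triangle n)" for x n
  proof (rule computes_PrimRec)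
    show "computes x (Comp (PrimRec (Proj 0) (Comp Succ [Proj 1]))
      [Proj 1, Comp Succ [Proj 0]]) [i, triangle i] (triangle (Suc i))" for i
      using computes_Comp2[OF computes.proj[of 1] computes_Succ_Comp[OF computes.proj[of 0]]
          computes_add, of "[i, triangle i]" x]
      by simp
  qed (simp add: computes.zero)
  then have "computable (\<lambda>x n. triangle n)"
    unfolding computable_def by blast
  from computable_compose[OF this assms] show ?thesis .
qed

lemma computable2_prod_encode: "computable2 (\<lambda>m n. prod_encode (m, n))"
proof -
  have "computable (\<lambda>x n. triangle n)"
    by (intro computable_triangle computable_id)
  then obtain T where T: "\<And>x n. computes x T [n] (triangle n)"
    unfolding computable_def by blast
  obtain A where A: "\<And>x m n. computes x A [m, n] (m + n)"
    using computes_add by blast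
  have "computes x (Comp A [Comp T [A], Proj 0]) [m, n] (triangle (m + n) + m)" for x m n
  proof (rule computes_Comp2[OF _ _ A])
    show "computes x (Comp T [A]) [m, n] (triangle (m + n))"
      by (rule computes_Comp1[OF A T])
    show "computes x (Proj 0) [m, n] m"
      by (simp add: computes_Proj)
  qed
  then have "\<forall>x m n. computes x (Comp A [Comp T [A], Proj 0]) [m, n] (prod_encode (m, n))"
    by (simp add: prod_encode_def)
  then show ?thesis
    unfolding computable2_def by blast
qed

lemmas computable_prod_encode = computable2D[OF computable2_prod_encode]

lemma binary_program_of_computable:
  assumes "computable (\<lambda>x m. G x (pfst m) (psnd m))"
  obtains \<Phi> where "\<And>x m n. computes x \<Phi> [m, n] (G x m n)"
proof -
  obtain \<Phi> where \<Phi>: "\<And>x m. computes x \<Phi> [m] (G x (pfst m) (psnd m))"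
    using computableE[OF assms] by blast
  obtain P where P: "\<And>x m n. computes x P [m, n] (prod_encode (m, n))"
    using computable2_prod_encode unfolding computable2_def by blast
  have "computes x (Comp \<Phi> [P]) [m, n] (G x m n)" for x m n
    using computes_Comp1[OF P \<Phi>, of x m n] by simp
  then show ?thesis by (rule that)
qed

lemma computes_Mu:
  assumes "\<And>k. computes x \<Phi> (k # ns) (of_bool (\<not> P k))" "P k"
  shows "computes x (Mu \<Phi>) ns (LEAST k. P k)"
proof (rule computes.mu)
  show "computes x \<Phi> ((LEAST k. P k) # ns) 0"
    using assms(1)[of "LEAST k. P k"] LeastI[of P, OF assms(2)] by simp
  show "\<forall>i<LEAST k. P k. \<exists>u. computes x \<Phi> (i # ns) (Suc u)"
  proof (intro allI impI exI)
    fix i assume "i < (LEAST k. P k)"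
    then show "computes x \<Phi> (i # ns) (Suc 0)"
      using assms(1)[of i] not_less_Least[of i P] by simp
  qed
qed

lemma triangle_mono: "m \<le> n \<Longrightarrow> triangle m \<le> triangle n"
  unfolding triangle_def by (intro div_le_mono mult_le_mono) auto

text \<open>
The pair \<open>(a, b)\<close> lies on diagonal number \<open>a + b\<close>, and the codes below \<open>triangle (Suc k)\<close> are those on
the diagonals up to \<open>k\<close>. Unpairing therefore amounts to a search for the diagonal.
\<close>

lemma less_triangle_prod_encode_iff:
  "prod_encode (a, b) < triangle (Suc k) \<longleftrightarrow> a + b \<le> k"
proof
  assume "a + b \<le> k"
  then have "triangle (Suc (a + b)) \<le> triangle (Suc k)"
    by (intro triangle_mono) simp
  then show "prod_encode (a, b) < triangle (Suc k)"
    by (simp add: prod_encode_def)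
next
  assume *: "prod_encode (a, b) < triangle (Suc k)"
  show "a + b \<le> k"
  proof (rule ccontr)
    assume "\<not> a + b \<le> k"
    then have "triangle (Suc k) \<le> triangle (a + b)"
      by (intro triangle_mono) simp
    with * show False by (simp add: prod_encode_def)
  qed
qed

lemma diagonal_eq_Least: "pfst n + psnd n = (LEAST k. n < triangle (Suc k))"
proof -
  have "n < triangle (Suc k) \<longleftrightarrow> pfst n + psnd n \<le> k" for k
    using less_triangle_prod_encode_iff[of "pfst n" "psnd n" k] by simp
  then show ?thesis
    by (intro Least_equality[symmetric]) simp_all
qed

lemma computable_diagonal: "computable (\<lambda>x n. pfst n + psnd n)"
proof -
  obtain M where M: "\<And>x m n. computes x M [m, n] (m - n)"
    using computable2_minus unfolding computable2_def by blast
  have "computable (\<lambda>x n. triangle (Suc n))" "computable (\<lambda>x n. Suc n)"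
    by (intro computable_triangle computable_Suc computable_id)+
  then obtain T S where T: "\<And>x n. computes x T [n] (triangle (Suc n))"
    and S: "\<And>x n. computes x S [n] (Suc n)"
    by (meson computableE)
  have *: "computable (\<lambda>x n. 1 - n)"
    by (intro computable_minus computable_const computable_id)
  then obtain C where C: "\<And>x n. computes x C [n] (1 - n)"
    by (meson computableE)
  let ?lt = "Comp C [Comp C [Comp M [Comp S [Proj 1], Comp T [Proj 0]]]]"
  have "computes x ?lt [k, n] (1 - (1 - (Suc n - triangle (Suc k))))" for x n k
    using computes_Comp1[OF computes_Comp1[OF computes_Comp2[OF
      computes_Comp1[OF computes.proj[of 1 "[k, n]"] S]
      computes_Comp1[OF computes.proj[of 0 "[k, n]"] T] M] C] C, of x] by simp
  moreover have "1 - (1 - (Suc n - triangle (Suc k))) = of_bool (\<not> n < triangle (Suc k))" for n k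
    by auto
  ultimately have "computes x ?lt [k, n] (of_bool (\<not> n < triangle (Suc k)))" for x n k
    by metis
  moreover have "n < triangle (Suc (pfst n + psnd n))" for n
    using less_triangle_prod_encode_iff[of "pfst n" "psnd n" "pfst n + psnd n"] by simp
  ultimately have "computes x (Mu ?lt) [n] (LEAST k. n < triangle (Suc k))" for x n
    by (rule computes_Mu)
  then show ?thesis
    unfolding diagonal_eq_Least by (rule computableI)
qed

lemma computable_pfst: assumes "computable F" shows "computable (\<lambda>x n. pfst (F x n))"
proof -
  have "pfst n = n - triangle (pfst n + psnd n)" for n
    using prod_encode_pfst_psnd[of n] unfolding prod_encode_def by simp
  moreover have "computable (\<lambda>x n. n - triangle (pfst n + psnd n))"
    by (intro computable_minus computable_id computable_triangle computable_diagonal)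
  ultimately have "computable (\<lambda>x n. pfst n)"
    by presburger
  from computable_compose[OF this assms] show ?thesis .
qed

lemma computable_psnd: assumes "computable F" shows "computable (\<lambda>x n. psnd (F x n))"
proof -
  have "computable (\<lambda>x n. (pfst n + psnd n) - pfst n)"
    by (intro computable_minus computable_diagonal computable_pfst computable_id)
  then have "computable (\<lambda>x n. psnd n)"
    by simp
  from computable_compose[OF this assms] show ?thesis .
qed

text \<open>
The step function \<open>G\<close> is given its three arguments, the counter, the previous value and the parameter,
in one tuple.
\<close>

lemma computable_rec_nat:
  assumes F: "computable F"
    and G: "computable (\<lambda>x m. G x (pfst m) (pfst (psnd m)) (psnd (psnd m)))"
    and B: "computable B"
  shows "computable (\<lambda>x n. rec_nat (F x n) (\<lambda>i u. G x i u n) (B x n))"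
proof -
  obtain f b where f: "\<And>x n. computes x f [n] (F x n)" and b: "\<And>x n. computes x b [n] (B x n)"
    using F B by (meson computableE)
  obtain g where g: "\<And>x m. computes x g [m] (G x (pfst m) (pfst (psnd m)) (psnd (psnd m)))"
    using computableE[OF G] by blast
  obtain P where P: "\<And>x m n. computes x P [m, n] (prod_encode (m, n))"
    using computable2_prod_encode unfolding computable2_def by blast
  let ?h = "\<lambda>x n. rec_nat (F x n) (\<lambda>i u. G x i u n)"
  let ?g = "Comp g [Comp P [Proj 0, Comp P [Proj 1, Proj 2]]]"
  have "computes x ?g [i, u, n] (G x i u n)" for x i u n
    using computes_Comp1[OF computes_Comp2[OF computes.proj[of 0 "[i, u, n]"]
      computes_Comp2[OF computes.proj[of 1 "[i, u, n]"] computes.proj[of 2 "[i, u, n]"] P] P] g, of x]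
    by (simp add: numeral_2_eq_2)
  then have "computes x (PrimRec f ?g) [m, n] (?h x n m)" for x m n
    using f by (intro computes_PrimRec) auto
  then have "computes x (Comp (PrimRec f ?g) [b, Proj 0]) [n] (?h x n (B x n))" for x n
    using computes_Comp2[OF b computes.proj[of 0 "[n]"], of x] by simp
  then show ?thesis by (rule computableI)
qed

lemma computable_of_bool: "decidable P \<Longrightarrow> computable (\<lambda>x n. of_bool (P x n))"
  by (simp add: decidable_def)

lemma decidable_not: assumes "decidable P" shows "decidable (\<lambda>x n. \<not> P x n)"
proof -
  have "computable (\<lambda>x n. 1 - of_bool (P x n))"
    by (intro computable_minus computable_const computable_of_bool assms)
  also have "(\<lambda>x n. 1 - of_bool (P x n)) = (\<lambda>x n. of_bool (\<not> P x n) :: nat)"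
    by (auto simp: fun_eq_iff)
  finally show ?thesis by (simp add: decidable_def)
qed

lemma decidable_conj:
  assumes "decidable P" "decidable Q" shows "decidable (\<lambda>x n. P x n \<and> Q x n)"
proof -
  have "computable (\<lambda>x n. of_bool (P x n) * of_bool (Q x n))"
    by (intro computable_mult computable_of_bool assms)
  then show ?thesis by (simp add: decidable_def of_bool_conj)
qed

lemma decidable_disj:
  assumes "decidable P" "decidable Q" shows "decidable (\<lambda>x n. P x n \<or> Q x n)"
  using decidable_not[OF decidable_conj[OF decidable_not[OF assms(1)] decidable_not[OF assms(2)]]]
  by simp

lemma decidable_imp:
  assumes "decidable P" "decidable Q" shows "decidable (\<lambda>x n. P x n \<longrightarrow> Q x n)"
  unfolding imp_conv_disj by (intro decidable_disj decidable_not assms)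

lemma decidable_less:
  assumes "computable F" "computable G" shows "decidable (\<lambda>x n. F x n < G x n)"
proof -
  have "computable (\<lambda>x n. 1 - (Suc (F x n) - G x n))"
    by (intro computable_minus computable_const computable_Suc assms)
  also have "(\<lambda>x n. 1 - (Suc (F x n) - G x n)) = (\<lambda>x n. of_bool (F x n < G x n))"
    by (auto simp: fun_eq_iff)
  finally show ?thesis by (simp add: decidable_def)
qed

lemma decidable_le:
  assumes "computable F" "computable G" shows "decidable (\<lambda>x n. F x n \<le> G x n)"
  unfolding not_less[symmetric] by (intro decidable_not decidable_less assms)

lemma decidable_eq:
  assumes "computable F" "computable G" shows "decidable (\<lambda>x n. F x n = G x n)"
  unfolding eq_iff by (intro decidable_conj decidable_le assms)

lemma decidable_iff:
  assumes "decidable P" "decidable Q" shows "decidable (\<lambda>x n. P x n \<longleftrightarrow> Q x n)"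
  unfolding iff_conv_conj_imp by (intro decidable_conj decidable_imp assms)

lemma computable_if:
  assumes "decidable P" "computable F" "computable G"
  shows "computable (\<lambda>x n. if P x n then F x n else G x n)"
proof -
  have "computable (\<lambda>x n. of_bool (P x n) * F x n + of_bool (\<not> P x n) * G x n)"
    by (intro computable_add computable_mult computable_of_bool decidable_not assms)
  also have "(\<lambda>x n. of_bool (P x n) * F x n + of_bool (\<not> P x n) * G x n) =
      (\<lambda>x n. if P x n then F x n else G x n)"
    by (auto simp: fun_eq_iff)
  finally show ?thesis .
qed

lemma decidable_if:
  assumes "decidable P" "decidable Q" "decidable R"
  shows "decidable (\<lambda>x n. if P x n then Q x n else R x n)"
  using computable_if[OF assms(1) assms(2,3)[unfolded decidable_def]]
  by (simp add: decidable_def if_distrib)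

lemma computable_sum:
  assumes "computable (\<lambda>x m. F x (pfst m) (psnd m))" "computable B"
  shows "computable (\<lambda>x n. \<Sum>i<B x n. F x i n)"
proof -
  have "computable (\<lambda>x m. F x (pfst m) (psnd (psnd m)))"
    using computable_compose[OF assms(1) computable_prod_encode[OF
      computable_pfst[OF computable_id] computable_psnd[OF computable_psnd[OF computable_id]]]]
    by simp
  then have "computable (\<lambda>x n. rec_nat 0 (\<lambda>i u. u + F x i n) (B x n))"
    by (intro computable_rec_nat[where G="\<lambda>x i u n. u + F x i n"] computable_const assms
      computable_add computable_pfst computable_psnd computable_id)
  moreover have "rec_nat 0 (\<lambda>i u. u + F x i n) b = (\<Sum>i<b. F x i n)" for x n b
    by (induction b) auto
  ultimately show ?thesis by simp
qed

lemma decidable_bex: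
  assumes "decidable (\<lambda>x m. P x (pfst m) (psnd m))" "computable B"
  shows "decidable (\<lambda>x n. \<exists>i<B x n. P x i n)"
proof -
  have "(\<exists>i<b. P x i n) \<longleftrightarrow> (\<Sum>i<b. of_bool (P x i n)) \<noteq> (0::nat)" for x b n
    unfolding sum_eq_0_iff[OF finite_lessThan] by auto
  moreover have "decidable (\<lambda>x n. (\<Sum>i<B x n. of_bool (P x i n)) \<noteq> (0::nat))"
    by (intro decidable_not decidable_eq computable_sum[where F="\<lambda>x i n. of_bool (P x i n)"]
      computable_of_bool computable_const assms)
  ultimately show ?thesis by simp
qed

lemma decidable_ball:
  assumes "decidable (\<lambda>x m. P x (pfst m) (psnd m))" "computable B"
  shows "decidable (\<lambda>x n. \<forall>i<B x n. P x i n)"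
  using decidable_not[OF decidable_bex[OF decidable_not[OF assms(1)] assms(2)]] by simp

lemma computable_Least:
  assumes P: "decidable (\<lambda>x m. P x (pfst m) (psnd m))" and ex: "\<And>x n. \<exists>k. P x k n"
  shows "computable (\<lambda>x n. LEAST k. P x k n)"
proof -
  obtain \<Phi> where "\<And>x k n. computes x \<Phi> [k, n] (of_bool (\<not> P x k n))"
    using binary_program_of_computable[of "\<lambda>x k n. of_bool (\<not> P x k n)"]
      decidable_not[OF P] unfolding decidable_def by blast
  then have "computes x (Mu \<Phi>) [n] (LEAST k. P x k n)" for x n
    using ex[of x n] by (blast intro: computes_Mu)
  then show ?thesis by (rule computableI)
qed

text \<open>
A form of division that is a bounded sum and hence inherits computability; the conjunct \<open>0 < d\<close> gives
the value 0 for division by zero.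
\<close>

lemma nat_div_eq_card: "(m::nat) div d = (\<Sum>q<m. of_bool (Suc q * d \<le> m \<and> 0 < d))"
proof (cases "d = 0")
  case False
  then have iff: "Suc q * d \<le> m \<longleftrightarrow> q < m div d" for q
    by (simp only: less_eq_div_iff_mult_less_eq[symmetric] Suc_le_eq neq0_conv)
  have "(\<Sum>q<m. of_bool (Suc q * d \<le> m \<and> 0 < d)) = (\<Sum>q\<in>{..<m div d}. 1::nat)"
    unfolding iff using False
    by (intro sum.mono_neutral_cong_right) (auto intro: less_le_trans)
  then show ?thesis by simp
qed simp

lemma computable_div:
  assumes "computable F" "computable G" shows "computable (\<lambda>x n. F x n div G x n)"
proof -
  have "computable (\<lambda>x n. pfst n div psnd n)"
    unfolding nat_div_eq_card
    by (intro computable_sum[where F="\<lambda>x q n. of_bool (Suc q * psnd n \<le> pfst n \<and> 0 < psnd n)"]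
      computable_of_bool decidable_conj decidable_le decidable_less computable_mult computable_Suc
      computable_pfst computable_psnd computable_id computable_const)
  from computable_compose[OF this computable_prod_encode[OF assms]] show ?thesis by simp
qed

lemma computable_mod:
  assumes "computable F" "computable G" shows "computable (\<lambda>x n. F x n mod G x n)"
  unfolding minus_div_mult_eq_mod[symmetric]
  by (intro computable_minus computable_mult computable_div assms)

lemma computable_power:
  assumes "computable F" "computable G" shows "computable (\<lambda>x n. F x n ^ G x n)"
proof -
  have "computable (\<lambda>x n. rec_nat 1 (\<lambda>i u. u * pfst n) (psnd n))"
    by (intro computable_rec_nat[where G="\<lambda>x i u n. u * pfst n"] computable_const
      computable_mult computable_pfst computable_psnd computable_id)
  moreover have "rec_nat 1 (\<lambda>i u. u * a) b = a ^ b" for a b :: nat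
    by (induction b) auto
  ultimately have "computable (\<lambda>x n. pfst n ^ psnd n)" by simp
  from computable_compose[OF this computable_prod_encode[OF assms]] show ?thesis by simp
qed

lemma decidable_bit:
  assumes "computable F" "computable G" shows "decidable (\<lambda>x n. bit (F x n) (G x n))"
proof -
  have "decidable (\<lambda>x n. \<not> (F x n div 2 ^ G x n) mod 2 = 0)"
    by (intro decidable_not decidable_eq computable_mod computable_div computable_power
      computable_const assms)
  then show ?thesis by (simp add: bit_iff_odd even_iff_mod_2_eq_zero)
qed

lemma decidable_even: assumes "computable F" shows "decidable (\<lambda>x n. even (F x n))"
  unfolding even_iff_mod_2_eq_zero
  by (intro decidable_eq computable_mod computable_const assms)

lemmas computable_intros =
  computable_id computable_const computable_Suc computable_add computable_minus computable_mult
  computable_div computable_mod computable_power computable_prod_encode computable_pfst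
  computable_psnd computable_of_bool computable_if computable_oracle decidable_not decidable_conj
  decidable_disj decidable_imp decidable_iff decidable_if decidable_eq decidable_le decidable_less
  decidable_bit decidable_even decidable_bex decidable_ball computable_sum

section \<open>Computations as finite certificates\<close>

text \<open>
List operations on the codes given by \<^const>\<open>list_encode\<close>. Every number codes a list, the number 0
codes the empty one.
\<close>

definition lcons :: "nat \<Rightarrow> nat \<Rightarrow> nat" where "lcons a c = Suc (prod_encode (a, c))"
definition lhd :: "nat \<Rightarrow> nat" where "lhd c = pfst (c - 1)"
definition ltl :: "nat \<Rightarrow> nat" where "ltl c = psnd (c - 1)"
definition llen :: "nat \<Rightarrow> nat" where "llen c = length (list_decode c)"
definition lnth :: "nat \<Rightarrow> nat \<Rightarrow> nat" where "lnth c i = lhd (rec_nat c (\<lambda>_. ltl) i)"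

lemma lcons_list_encode [simp]: "lcons a (list_encode ns) = list_encode (a # ns)"
  by (simp add: lcons_def)

lemma lhd_list_encode [simp]: "lhd (list_encode (a # ns)) = a"
  by (simp add: lhd_def)

lemma ltl_list_encode [simp]: "ltl (list_encode ns) = list_encode (tl ns)"
proof (cases ns)
  case Nil
  have "prod_encode (0, 0) = 0"
    by (simp add: prod_encode_def)
  then have "psnd 0 = 0"
    by (metis psnd_prod_encode)
  with Nil show ?thesis by (simp add: ltl_def)
qed (simp add: ltl_def)

lemma list_encode_eq_0_iff [simp]: "list_encode ns = 0 \<longleftrightarrow> ns = []"
  by (cases ns) auto

lemma llen_list_encode [simp]: "llen (list_encode ns) = length ns"
  by (simp add: llen_def)

lemma rec_ltl: "rec_nat (list_encode ns) (\<lambda>_. ltl) i = list_encode (drop i ns)"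
  by (induction i) (simp_all add: drop_Suc tl_drop)

lemma lnth_list_encode [simp]: "i < length ns \<Longrightarrow> lnth (list_encode ns) i = ns ! i"
  unfolding lnth_def rec_ltl Cons_nth_drop_Suc[symmetric] lhd_list_encode ..

declare list_encode.simps [simp del]

lemma computable_lcons:
  assumes "computable F" "computable G" shows "computable (\<lambda>x n. lcons (F x n) (G x n))"
  unfolding lcons_def by (intro computable_intros assms)

lemma computable_lhd: assumes "computable F" shows "computable (\<lambda>x n. lhd (F x n))"
  unfolding lhd_def by (intro computable_intros assms)

lemma computable_ltl: assumes "computable F" shows "computable (\<lambda>x n. ltl (F x n))"
  unfolding ltl_def by (intro computable_intros assms)

lemma computable_rec_ltl:
  assumes "computable F" "computable G"
  shows "computable (\<lambda>x n. rec_nat (F x n) (\<lambda>_. ltl) (G x n))"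
  by (rule computable_rec_nat[where G="\<lambda>x i u n. ltl u"])
     (intro computable_ltl computable_intros assms)+

lemma computable_lnth:
  assumes "computable F" "computable G" shows "computable (\<lambda>x n. lnth (F x n) (G x n))"
  unfolding lnth_def by (intro computable_lhd computable_rec_ltl assms)

lemma llen_eq_Least: "llen c = (LEAST i. rec_nat c (\<lambda>_. ltl) i = 0)"
proof -
  obtain ns where "c = list_encode ns"
    by (metis list_decode_inverse)
  then show ?thesis
    by (simp add: rec_ltl) (rule Least_equality[symmetric]; simp)
qed

lemma computable_llen: assumes "computable F" shows "computable (\<lambda>x n. llen (F x n))"
proof -
  have "\<exists>i. rec_nat c (\<lambda>_. ltl) i = 0" for c
    by (rule exI[of _ "llen c"]) (metis list_decode_inverse rec_ltl llen_def drop_all le_refl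
      list_encode_eq_0_iff)
  then have "computable (\<lambda>x n. LEAST i. rec_nat n (\<lambda>_. ltl) i = 0)"
    by (intro computable_Least decidable_eq computable_rec_ltl computable_intros)
  from computable_compose[OF this assms] show ?thesis
    by (simp only: llen_eq_Least)
qed

primrec program_code :: "functional \<Rightarrow> nat" where
  "program_code Zero = prod_encode (0, 0)"
| "program_code Succ = prod_encode (1, 0)"
| "program_code (Proj i) = prod_encode (2, i)"
| "program_code Query = prod_encode (3, 0)"
| "program_code (Comp f gs) =
    prod_encode (4, prod_encode (program_code f, list_encode (map program_code gs)))"
| "program_code (PrimRec f g) = prod_encode (5, prod_encode (program_code f, program_code g))"
| "program_code (Mu f) = prod_encode (6, program_code f)"

definition fact_code :: "nat \<Rightarrow> nat \<Rightarrow> nat \<Rightarrow> nat" where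
  "fact_code e ns v = prod_encode (e, prod_encode (ns, v))"
definition fprog :: "nat \<Rightarrow> nat" where "fprog \<phi> = pfst \<phi>"
definition fargs :: "nat \<Rightarrow> nat" where "fargs \<phi> = pfst (psnd \<phi>)"
definition fval :: "nat \<Rightarrow> nat" where "fval \<phi> = psnd (psnd \<phi>)"

lemma fact_code_simps [simp]:
  "fprog (fact_code e ns v) = e" "fargs (fact_code e ns v) = ns" "fval (fact_code e ns v) = v"
  by (simp_all add: fact_code_def fprog_def fargs_def fval_def)

text \<open>
A fact is the code of a triple of program, argument list and value. The fact \<open>\<phi>\<close> follows from the
facts in \<open>S\<close> by one of the clauses of \<^const>\<open>computes\<close>, where the tag of the program decides which
clauses can apply. The oracle may be queried only below \<open>u\<close>, which makes certificates finite objects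
even with respect to the oracle.
\<close>

definition infers :: "cantor \<Rightarrow> nat \<Rightarrow> nat set \<Rightarrow> nat \<Rightarrow> bool" where
  "infers z u S \<phi> \<longleftrightarrow>
    (pfst (fprog \<phi>) = 0 \<and> fval \<phi> = 0) \<or>
    (pfst (fprog \<phi>) = 1 \<and> llen (fargs \<phi>) = 1 \<and> fval \<phi> = Suc (lhd (fargs \<phi>))) \<or>
    (pfst (fprog \<phi>) = 2 \<and> psnd (fprog \<phi>) < llen (fargs \<phi>) \<and>
      fval \<phi> = lnth (fargs \<phi>) (psnd (fprog \<phi>))) \<or>
    (pfst (fprog \<phi>) = 3 \<and> llen (fargs \<phi>) = 1 \<and> lhd (fargs \<phi>) < u \<and>
      fval \<phi> = of_bool (z (lhd (fargs \<phi>)))) \<or>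
    (pfst (fprog \<phi>) = 4 \<and>
      (\<exists>\<psi>\<in>S. fprog \<psi> = pfst (psnd (fprog \<phi>)) \<and> fval \<psi> = fval \<phi> \<and>
        llen (fargs \<psi>) = llen (psnd (psnd (fprog \<phi>))) \<and>
        (\<forall>l<llen (psnd (psnd (fprog \<phi>))). \<exists>\<theta>\<in>S.
          \<theta> = fact_code (lnth (psnd (psnd (fprog \<phi>))) l) (fargs \<phi>) (lnth (fargs \<psi>) l)))) \<or>
    (pfst (fprog \<phi>) = 5 \<and> 0 < llen (fargs \<phi>) \<and> lhd (fargs \<phi>) = 0 \<and>
      (\<exists>\<theta>\<in>S. \<theta> = fact_code (pfst (psnd (fprog \<phi>))) (ltl (fargs \<phi>)) (fval \<phi>))) \<or>
    (pfst (fprog \<phi>) = 5 \<and> 0 < llen (fargs \<phi>) \<and> 0 < lhd (fargs \<phi>) \<and>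
      (\<exists>\<psi>\<in>S. fprog \<psi> = fprog \<phi> \<and> fargs \<psi> = lcons (lhd (fargs \<phi>) - 1) (ltl (fargs \<phi>)) \<and>
        (\<exists>\<theta>\<in>S. \<theta> = fact_code (psnd (psnd (fprog \<phi>)))
          (lcons (lhd (fargs \<phi>) - 1) (lcons (fval \<psi>) (ltl (fargs \<phi>)))) (fval \<phi>)))) \<or>
    (pfst (fprog \<phi>) = 6 \<and>
      (\<exists>\<theta>\<in>S. \<theta> = fact_code (psnd (fprog \<phi>)) (lcons (fval \<phi>) (fargs \<phi>)) 0) \<and>
      (\<forall>l<fval \<phi>. \<exists>\<psi>\<in>S. fprog \<psi> = psnd (fprog \<phi>) \<and> fargs \<psi> = lcons l (fargs \<phi>) \<and>
        0 < fval \<psi>))"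

lemma infers_mono:
  assumes "infers z u S \<phi>" "S \<subseteq> T" "u \<le> w" shows "infers z w T \<phi>"
  using assms(1) unfolding infers_def
  by (elim disj_forward conj_forward; use assms(2,3) in \<open>(assumption | linarith | blast)\<close>)

lemma infers_cong:
  assumes "\<And>i. i < u \<Longrightarrow> z i = z' i" shows "infers z u S \<phi> = infers z' u S \<phi>"
  unfolding infers_def using assms by (simp cong: conj_cong)

text \<open>
A certificate may contain facts about numbers that code no program. They cannot support a fact about a
program, because the immediate parts of a program code are program codes again.
\<close>

definition fact_holds :: "cantor \<Rightarrow> nat \<Rightarrow> bool" where
  "fact_holds z \<phi> \<longleftrightarrow> (\<forall>\<Phi> ns. fprog \<phi> = program_code \<Phi> \<longrightarrow> fargs \<phi> = list_encode ns \<longrightarrow>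
    computes z \<Phi> ns (fval \<phi>))"

lemma infers_sound:
  assumes S: "\<And>\<psi>. \<psi> \<in> S \<Longrightarrow> fact_holds z \<psi>" and "infers z u S \<phi>"
  shows "fact_holds z \<phi>"
  unfolding fact_holds_def
proof (intro allI impI)
  fix \<Phi> ns
  assume e: "fprog \<phi> = program_code \<Phi>" and ns: "fargs \<phi> = list_encode ns"
  have S: "computes z \<Psi> ms (fval \<psi>)"
    if "\<psi> \<in> S" "fprog \<psi> = program_code \<Psi>" "fargs \<psi> = list_encode ms" for \<psi> \<Psi> ms
    using S[OF that(1)] that(2,3) unfolding fact_holds_def by blast
  have fact: "computes z \<Psi> ms v" if "fact_code (program_code \<Psi>) (list_encode ms) v \<in> S" for \<Psi> ms v
    using S[OF that] by simp
  note inf = assms(2)[unfolded infers_def e ns]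
  show "computes z \<Phi> ns (fval \<phi>)"
  proof (cases \<Phi>)
    case Zero
    with inf show ?thesis by (auto intro: computes.zero)
  next
    case Succ
    with inf show ?thesis by (auto intro!: computes.succ simp: length_Suc_conv)
  next
    case (Proj i)
    with inf show ?thesis by (auto intro!: computes.proj)
  next
    case Query
    with inf obtain n where "ns = [n]" "fval \<phi> = of_bool (z n)"
      by (auto simp: length_Suc_conv)
    with Query show ?thesis by (metis computes.query)
  next
    case (Comp f gs)
    with inf obtain \<psi> where \<psi>: "\<psi> \<in> S" "fprog \<psi> = program_code f" "fval \<psi> = fval \<phi>"
      "llen (fargs \<psi>) = length gs"
      "\<forall>l<length gs. fact_code (lnth (list_encode (map program_code gs)) l) (list_encode ns)
        (lnth (fargs \<psi>) l) \<in> S"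
      by auto
    obtain ms where ms: "fargs \<psi> = list_encode ms"
      by (metis list_decode_inverse)
    have "list_all2 (\<lambda>g m. computes z g ns m) gs ms"
      using \<psi>(4,5) fact by (auto simp: list_all2_conv_all_nth ms)
    moreover have "computes z f ms (fval \<phi>)"
      using S[OF \<psi>(1,2) ms] \<psi>(3) by simp
    ultimately show ?thesis
      unfolding Comp by (rule computes.comp)
  next
    case (PrimRec f g)
    with inf obtain n ms where [simp]: "ns = n # ms"
      by (cases ns) auto
    show ?thesis
    proof (cases n)
      case 0
      with inf PrimRec have "fact_code (program_code f) (list_encode ms) (fval \<phi>) \<in> S"
        by auto
      with 0 PrimRec show ?thesis by (simp add: computes.rec_0 fact)
    next
      case (Suc m)
      with inf PrimRec obtain \<psi> where "\<psi> \<in> S" "fprog \<psi> = program_code (PrimRec f g)"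
        "fargs \<psi> = list_encode (m # ms)"
        "fact_code (program_code g) (list_encode (m # fval \<psi> # ms)) (fval \<phi>) \<in> S"
        by (auto)
      with S fact show ?thesis
        unfolding PrimRec Suc \<open>ns = n # ms\<close> by (blast intro: computes.rec_Suc)
    qed
  next
    case (Mu f)
    with inf have 0: "fact_code (program_code f) (list_encode (fval \<phi> # ns)) 0 \<in> S"
      and less: "\<forall>l<fval \<phi>. \<exists>\<psi>\<in>S. fprog \<psi> = program_code f \<and> fargs \<psi> = list_encode (l # ns) \<and>
        0 < fval \<psi>"
      by (auto)
    have "\<exists>u. computes z f (l # ns) (Suc u)" if "l < fval \<phi>" for l
      using less S that by (metis Suc_pred)
    with fact[OF 0] show ?thesis
      unfolding Mu by (blast intro: computes.mu)
  qed
qed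

text \<open>
Each fact is justified by facts that come later in the list, so certificates can be concatenated.
\<close>

primrec certificate :: "cantor \<Rightarrow> nat \<Rightarrow> nat list \<Rightarrow> bool" where
  "certificate z u [] \<longleftrightarrow> True"
| "certificate z u (\<phi> # cs) \<longleftrightarrow> infers z u (set cs) \<phi> \<and> certificate z u cs"

lemma certificate_sound: "certificate z u cs \<Longrightarrow> \<phi> \<in> set cs \<Longrightarrow> fact_holds z \<phi>"
proof (induction cs arbitrary: \<phi>)
  case (Cons \<psi> cs)
  then show ?case using infers_sound[of "set cs" z u \<psi>] by auto
qed simp

lemma certificate_mono: "certificate z u cs \<Longrightarrow> u \<le> w \<Longrightarrow> certificate z w cs"
  by (induction cs) (auto intro: infers_mono)

lemma certificate_cong: "(\<And>i. i < u \<Longrightarrow> z i = z' i) \<Longrightarrow> certificate z u cs = certificate z' u cs"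
  by (induction cs) (auto simp: infers_cong[of u z z'])

lemma certificate_append:
  "certificate z u cs \<Longrightarrow> certificate z u ds \<Longrightarrow> certificate z u (cs @ ds)"
  by (induction cs) (auto elim: infers_mono)

definition certified :: "cantor \<Rightarrow> nat \<Rightarrow> bool" where
  "certified z \<phi> \<longleftrightarrow> (\<exists>u cs. certificate z u cs \<and> \<phi> \<in> set cs)"

text \<open>
Certificates of finitely many facts are merged by concatenation after their query bounds have been
raised to a common one. This is what the scheme for composition, with its list of inner programs, and
the scheme for minimisation, with its values below the minimum, need.
\<close>

lemma certified_finite:
  assumes "finite S" "\<And>\<phi>. \<phi> \<in> S \<Longrightarrow> certified z \<phi>"
  shows "\<exists>u cs. certificate z u cs \<and> S \<subseteq> set cs"
  using assms
proof (induction S)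
  case empty
  show ?case by (rule exI, rule exI[of _ "[]"]) simp
next
  case (insert \<phi> S)
  then obtain u cs where cs: "certificate z u cs" "S \<subseteq> set cs" by auto
  from insert obtain w ds where ds: "certificate z w ds" "\<phi> \<in> set ds"
    unfolding certified_def by blast
  have "certificate z (max u w) (cs @ ds)"
    using certificate_mono[OF cs(1)] certificate_mono[OF ds(1)] by (intro certificate_append) auto
  then show ?case using cs(2) ds(2) by (intro exI[of _ "max u w"] exI[of _ "cs @ ds"]) auto
qed

lemma certified_infers:
  assumes "infers z u S \<phi>" "finite S" "\<And>\<psi>. \<psi> \<in> S \<Longrightarrow> certified z \<psi>"
  shows "certified z \<phi>"
proof -
  obtain w cs where cs: "certificate z w cs" "S \<subseteq> set cs"
    using certified_finite[OF assms(2,3)] by blast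
  have "certificate z (max u w) (\<phi> # cs)"
    using certificate_mono[OF cs(1), of "max u w"] infers_mono[OF assms(1) cs(2), of "max u w"]
    by simp
  then show ?thesis unfolding certified_def by (metis list.set_intros(1))
qed

lemma computes_certified:
  assumes "computes z \<Phi> ns v"
  shows "certified z (fact_code (program_code \<Phi>) (list_encode ns) v)"
  using assms
proof (induction rule: computes.induct)
  case (zero ns)
  have "infers z 0 {} (fact_code (program_code Zero) (list_encode ns) 0)"
    unfolding infers_def by simp
  then show ?case by (rule certified_infers) simp_all
next
  case (succ n)
  have "infers z 0 {} (fact_code (program_code Succ) (list_encode [n]) (Suc n))"
    unfolding infers_def by simp
  then show ?case by (rule certified_infers) simp_all
next
  case (proj i ns)
  then have "infers z 0 {} (fact_code (program_code (Proj i)) (list_encode ns) (ns ! i))"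
    unfolding infers_def by simp
  then show ?case by (rule certified_infers) simp_all
next
  case (query n)
  have "infers z (Suc n) {} (fact_code (program_code Query) (list_encode [n]) (of_bool (z n)))"
    unfolding infers_def by simp
  then show ?case by (rule certified_infers) simp_all
next
  case (comp ns gs ms f v)
  let ?S = "insert (fact_code (program_code f) (list_encode ms) v)
    ((\<lambda>l. fact_code (program_code (gs ! l)) (list_encode ns) (ms ! l)) ` {..<length gs})"
  have len: "length ms = length gs"
    and gs: "\<And>l. l < length gs \<Longrightarrow>
      certified z (fact_code (program_code (gs ! l)) (list_encode ns) (ms ! l))"
    using comp(1) by (simp_all add: list_all2_conv_all_nth)
  have "infers z 0 ?S (fact_code (program_code (Comp f gs)) (list_encode ns) v)"
    unfolding infers_def by (simp add: len)
  then show ?case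
    by (rule certified_infers) (use gs comp.IH in blast)+
next
  case (rec_0 f ns v g)
  have "infers z 0 {fact_code (program_code f) (list_encode ns) v}
      (fact_code (program_code (PrimRec f g)) (list_encode (0 # ns)) v)"
    unfolding infers_def by simp
  then show ?case
    by (rule certified_infers) (use rec_0.IH in blast)+
next
  case (rec_Suc f g k ns u v)
  have "infers z 0 {fact_code (program_code (PrimRec f g)) (list_encode (k # ns)) u,
            fact_code (program_code g) (list_encode (k # u # ns)) v}
      (fact_code (program_code (PrimRec f g)) (list_encode (Suc k # ns)) v)"
    unfolding infers_def by simp
  then show ?case
    by (rule certified_infers) (use rec_Suc.IH in blast)+
next
  case (mu f k ns)
  then have "\<forall>i. \<exists>u. i < k \<longrightarrow>
      certified z (fact_code (program_code f) (list_encode (i # ns)) (Suc u))"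
    by blast
  then obtain u where u: "\<And>i. i < k \<Longrightarrow>
      certified z (fact_code (program_code f) (list_encode (i # ns)) (Suc (u i)))"
    using choice[of "\<lambda>i u. i < k \<longrightarrow>
      certified z (fact_code (program_code f) (list_encode (i # ns)) (Suc u))"] by blast
  let ?S = "insert (fact_code (program_code f) (list_encode (k # ns)) 0)
    ((\<lambda>i. fact_code (program_code f) (list_encode (i # ns)) (Suc (u i))) ` {..<k})"
  have "infers z 0 ?S (fact_code (program_code (Mu f)) (list_encode ns) k)"
    unfolding infers_def by auto
  then show ?case
    by (rule certified_infers) (use mu.IH(1) u in blast)+
qed

definition says :: "cantor \<Rightarrow> nat \<Rightarrow> nat \<Rightarrow> nat \<Rightarrow> nat \<Rightarrow> bool \<Rightarrow> bool" where
  "says z u c e p b \<longleftrightarrow> certificate z u (list_decode c) \<and>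
    (\<exists>\<phi>\<in>set (list_decode c). \<phi> = fact_code e (lcons p 0) (of_bool b))"

lemma says_mono: "says z u c e p b \<Longrightarrow> u \<le> w \<Longrightarrow> says z w c e p b"
  unfolding says_def using certificate_mono by blast

lemma says_cong: "(\<And>i. i < u \<Longrightarrow> z i = z' i) \<Longrightarrow> says z u c e p b = says z' u c e p b"
  unfolding says_def using certificate_cong by blast

text \<open>
The normal form theorem: a computation is recognised by a search over certificates that see only
finitely many bits of the oracle.
\<close>

lemma computes_iff_says:
  "computes z \<Phi> [p] (of_bool b) \<longleftrightarrow> (\<exists>u c. says z u c (program_code \<Phi>) p b)"
proof
  assume "computes z \<Phi> [p] (of_bool b)"
  then obtain u cs where "certificate z u cs"
      "fact_code (program_code \<Phi>) (list_encode [p]) (of_bool b) \<in> set cs"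
    using computes_certified unfolding certified_def by blast
  then have "says z u (list_encode cs) (program_code \<Phi>) p b"
    by (simp add: says_def lcons_def list_encode.simps)
  then show "\<exists>u c. says z u c (program_code \<Phi>) p b" by blast
next
  assume "\<exists>u c. says z u c (program_code \<Phi>) p b"
  then have "fact_holds z (fact_code (program_code \<Phi>) (lcons p 0) (of_bool b))"
    unfolding says_def using certificate_sound by blast
  then show "computes z \<Phi> [p] (of_bool b)"
    unfolding fact_holds_def by (simp add: lcons_def list_encode.simps)
qed

lemma certificate_iff_nth:
  "certificate z u cs \<longleftrightarrow> (\<forall>i<length cs. infers z u (set (drop (Suc i) cs)) (cs ! i))"
  by (induction cs) (auto simp: less_Suc_eq_0_disj)

lemma bex_set_drop: "(\<exists>\<psi>\<in>set (drop m cs). P \<psi>) \<longleftrightarrow> (\<exists>j<length cs. m \<le> j \<and> P (cs ! j))"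
proof
  assume "\<exists>\<psi>\<in>set (drop m cs). P \<psi>"
  then obtain i where "i < length cs - m" "P (drop m cs ! i)"
    by (auto simp: in_set_conv_nth)
  then show "\<exists>j<length cs. m \<le> j \<and> P (cs ! j)"
    by (intro exI[of _ "m + i"]) simp
next
  assume "\<exists>j<length cs. m \<le> j \<and> P (cs ! j)"
  then obtain j where j: "j < length cs" "m \<le> j" "P (cs ! j)" by blast
  then have "drop m cs ! (j - m) \<in> set (drop m cs)"
    by (intro nth_mem) simp
  with j show "\<exists>\<psi>\<in>set (drop m cs). P \<psi>"
    by (intro bexI[of _ "drop m cs ! (j - m)"]) simp_all
qed

lemma list_decode_nth: "i < llen c \<Longrightarrow> list_decode c ! i = lnth c i"
  using lnth_list_encode[of i "list_decode c"] by (simp add: llen_def)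

lemma bex_list_code:
  "(\<exists>\<psi>\<in>set (drop m (list_decode c)). P \<psi>) \<longleftrightarrow> (\<exists>j<llen c. m \<le> j \<and> P (lnth c j))"
  "(\<exists>\<psi>\<in>set (list_decode c). P \<psi>) \<longleftrightarrow> (\<exists>j<llen c. P (lnth c j))"
  using bex_set_drop[of m "list_decode c" P] bex_set_drop[of 0 "list_decode c" P]
  by (auto simp: llen_def[symmetric] list_decode_nth)

lemma computable_fact_code:
  assumes "computable E" "computable F" "computable G"
  shows "computable (\<lambda>x n. fact_code (E x n) (F x n) (G x n))"
  unfolding fact_code_def by (intro computable_intros assms)

lemma computable_fprog: assumes "computable F" shows "computable (\<lambda>x n. fprog (F x n))"
  unfolding fprog_def by (intro computable_intros assms)

lemma computable_fargs: assumes "computable F" shows "computable (\<lambda>x n. fargs (F x n))"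
  unfolding fargs_def by (intro computable_intros assms)

lemma computable_fval: assumes "computable F" shows "computable (\<lambda>x n. fval (F x n))"
  unfolding fval_def by (intro computable_intros assms)

lemmas computable_list_intros =
  computable_lcons computable_lhd computable_ltl computable_llen computable_lnth
  computable_fact_code computable_fprog computable_fargs computable_fval computable_intros

text \<open>
The oracle of the certificate is a parameter that may itself be any decidable predicate, not only the
oracle of the deciding program.
\<close>

lemma decidable_certificate:
  assumes "decidable (\<lambda>x m. Z x (psnd m) (pfst m))" "computable U" "computable C"
  shows "decidable (\<lambda>x n. certificate (Z x n) (U x n) (list_decode (C x n)))"
proof -
  have Z: "decidable (\<lambda>x m. Z x (N x m) (I x m))" if "computable N" "computable I" for N I
    using computable_compose[OF assms(1)[unfolded decidable_def] computable_prod_encode[OF that(2,1)]]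
    by (simp add: decidable_def)
  have eq: "certificate z u (list_decode c) \<longleftrightarrow>
      (\<forall>i<llen c. infers z u (set (drop (Suc i) (list_decode c))) (lnth c i))" for z u c
    unfolding certificate_iff_nth llen_def[symmetric] using list_decode_nth by auto
  note UC = computable_compose[OF assms(2)] computable_compose[OF assms(3)]
  show ?thesis
    unfolding eq infers_def bex_list_code(1)
    by (intro computable_list_intros UC Z)
qed

lemma decidable_join:
  assumes "decidable (\<lambda>x m. Y x (psnd m) (pfst m))" "decidable (\<lambda>x m. R x (psnd m) (pfst m))"
  shows "decidable (\<lambda>x m. (Y x (psnd m) \<squnion>\<squnion> R x (psnd m)) (pfst m))"
proof -
  have *: "decidable (\<lambda>x m. Z x (N x m) (I x m))"
    if "decidable (\<lambda>x m. Z x (psnd m) (pfst m))" "computable N" "computable I"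
    for N I and Z :: "cantor \<Rightarrow> nat \<Rightarrow> nat \<Rightarrow> bool"
    using computable_compose[OF that(1)[unfolded decidable_def] computable_prod_encode[OF that(3,2)]]
    by (simp add: decidable_def)
  show ?thesis
    unfolding join_def by (intro computable_intros *[OF assms(1)] *[OF assms(2)])
qed

lemma decidable_says:
  assumes "decidable (\<lambda>x m. Z x (psnd m) (pfst m))" "computable U" "computable C"
    "computable E" "computable P" "decidable B"
  shows "decidable (\<lambda>x n. says (Z x n) (U x n) (C x n) (E x n) (P x n) (B x n))"
proof -
  show ?thesis
    unfolding says_def bex_list_code(2)
    by (intro decidable_certificate computable_list_intros assms
      computable_compose[OF assms(3)] computable_compose[OF assms(4)]
      computable_compose[OF assms(5)] computable_compose[OF assms(6)[unfolded decidable_def], folded decidable_def])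
qed

section \<open>The function and its domain\<close>

text \<open>
The first \<open>n\<close> bits of a real as a binary number. Computable predicates of finite strings are
expressed through it, with \<open>bit v\<close> as the real that continues the string \<open>v\<close> by zeros.
\<close>

definition prefix_code :: "cantor \<Rightarrow> nat \<Rightarrow> nat" where
  "prefix_code x n = horner_sum of_bool 2 (map x [0..<n])"

lemma prefix_code_0: "prefix_code x 0 = 0"
  by (simp add: prefix_code_def)

lemma prefix_code_Suc: "prefix_code x (Suc n) = prefix_code x n + of_bool (x n) * 2 ^ n"
  by (simp add: prefix_code_def horner_sum_append)

lemma bit_prefix_code [simp]: "bit (prefix_code x n) i \<longleftrightarrow> i < n \<and> x i"
  by (auto simp: prefix_code_def bit_horner_sum_bit_iff)

lemma prefix_code_less: "prefix_code x n < 2 ^ n"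
  by (induction n) (auto simp: prefix_code_0 prefix_code_Suc)

lemma prefix_code_mod: "a \<le> n \<Longrightarrow> prefix_code x n mod 2 ^ a = prefix_code x a"
  unfolding take_bit_eq_mod[symmetric] prefix_code_def take_bit_horner_sum_bit_eq
  by (simp add: take_map)

lemma prefix_code_eq_iff: "v < 2 ^ n \<Longrightarrow> prefix_code x n = v \<longleftrightarrow> (\<forall>i<n. x i = bit v i)"
proof
  assume "v < 2 ^ n" "\<forall>i<n. x i = bit v i"
  then have "map x [0..<n] = map (bit v) [0..<n]" by simp
  with \<open>v < 2 ^ n\<close> show "prefix_code x n = v"
    unfolding prefix_code_def by (metis horner_sum_bit_eq_take_bit take_bit_nat_eq_self)
qed auto

definition cell :: "nat \<Rightarrow> nat \<Rightarrow> nat \<Rightarrow> nat" where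
  "cell k s i = prod_encode (prod_encode (k, s), i)"

lemma cell_eq_iff [simp]: "cell k s i = cell k' s' i' \<longleftrightarrow> k = k' \<and> s = s' \<and> i = i'"
  by (simp add: cell_def prod_encode_eq)

lemma cell_projections [simp]:
  "pfst (cell k s i) = prod_encode (k, s)" "psnd (cell k s i) = i"
  by (simp_all add: cell_def)

lemma cell_cases: obtains k s i where "n = cell k s i"
  by (metis cell_def prod_encode_pfst_psnd)

lemma le_cell: "s \<le> cell k s i"
  unfolding cell_def using le_prod_encode_2[of s k] le_prod_encode_1[of "prod_encode (k, s)" i]
  by linarith

text \<open>
The closing zero matters: once the leading ones are removed, the column begins with 0 and does
not wait any more.
\<close>

definition waits :: "cantor \<Rightarrow> nat \<Rightarrow> nat \<Rightarrow> bool" where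
  "waits x k s \<longleftrightarrow> (\<forall>i<k + 2. x (cell k s i)) \<and> \<not> x (cell k s (k + 2))"

text \<open>
Requirement \<open>k\<close> is the triple \<open>(e, a, d)\<close> of the code of a program and the cylinder of the reals whose
first \<open>a\<close> bits have the code \<open>d\<close>. The set consists of the strings of length \<open>t\<close> in this cylinder that
make the program answer with the first bit of column \<open>(k, s)\<close> as \<open>y\<close> shows it. That bit belongs to position
\<open>cell k s 0\<close> of \<open>x\<close>; in \<open>y\<close> it stands one cell later, as \<open>cell k s 0\<close> of \<open>y\<close> is a marker.
\<close>

definition correct_codes :: "cantor \<Rightarrow> nat \<Rightarrow> nat \<Rightarrow> nat \<Rightarrow> nat set" where
  "correct_codes y k s t = {v. v < 2 ^ t \<and> v mod 2 ^ pfst (psnd k) = psnd (psnd k) \<and>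
    (\<exists>c<t. says (y \<squnion>\<squnion> bit v) (2 * t) c (pfst k) (cell k s 0) (y (cell k s 1)))}"

text \<open>
The last conjunct says that more than half of the \<open>2 ^ (t - a)\<close> strings of length \<open>t\<close> in the cylinder
agree with \<open>y\<close>. The conjuncts before it make the definition depend only on the first \<open>t\<close> bits of \<open>y\<close>
and make \<open>t - a\<close> a true difference.
\<close>

definition fires :: "cantor \<Rightarrow> nat \<Rightarrow> nat \<Rightarrow> nat \<Rightarrow> bool" where
  "fires y k s t \<longleftrightarrow> s < t \<and> cell k s 1 < t \<and> pfst (psnd k) \<le> t \<and>
    2 ^ t < 2 * 2 ^ pfst (psnd k) * card (correct_codes y k s t)"

text \<open>
The stage at which the current attempt of requirement \<open>k\<close> has started; a new attempt starts at the
very stage at which the current one fires. All this depends on the output \<open>y\<close> alone, so whoever knows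
\<open>y\<close> can follow the history of attempts, but not whether an attempt will ever fire.
\<close>

primrec last_start :: "cantor \<Rightarrow> nat \<Rightarrow> nat \<Rightarrow> nat" where
  "last_start y k 0 = 0"
| "last_start y k (Suc t) =
    (if fires y k (last_start y k t) (Suc t) then Suc t else last_start y k t)"

definition starts :: "cantor \<Rightarrow> nat \<Rightarrow> nat \<Rightarrow> bool" where
  "starts y k s \<longleftrightarrow> last_start y k s = s"

lemma join_cong_less: "(\<And>i. i < t \<Longrightarrow> y i = y' i) \<Longrightarrow> (\<And>i. i < t \<Longrightarrow> r i = r' i) \<Longrightarrow>
    n < 2 * t \<Longrightarrow> (y \<squnion>\<squnion> r) n = (y' \<squnion>\<squnion> r') n"
  by (auto simp: join_def)

text \<open>
Locality in \<open>y\<close> is what makes it possible to define the output by recursion although the attempts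
refer to it.
\<close>

lemma fires_cong:
  assumes "\<And>i. i < t \<Longrightarrow> y i = y' i" shows "fires y k s t = fires y' k s t"
proof (cases "cell k s 1 < t")
  case True
  have "says (y \<squnion>\<squnion> r) (2 * t) c e p b = says (y' \<squnion>\<squnion> r) (2 * t) c e p b" for r c e p b
    by (intro says_cong join_cong_less assms refl)
  with assms[OF True] show ?thesis
    unfolding fires_def correct_codes_def by simp
qed (simp add: fires_def)

lemma last_start_cong:
  "(\<And>i. i < t \<Longrightarrow> y i = y' i) \<Longrightarrow> last_start y k t = last_start y' k t"
proof (induction t)
  case (Suc t)
  then show ?case using fires_cong[of "Suc t" y y'] by simp
qed simp

lemma starts_cong: "(\<And>i. i < s \<Longrightarrow> y i = y' i) \<Longrightarrow> starts y k s = starts y' k s"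
  unfolding starts_def using last_start_cong[of s y y' k] by simp

lemma last_start_le: "last_start y k t \<le> t"
  by (induction t) auto

lemma starts_0: "starts y k 0"
  by (simp add: starts_def)

lemma fires_if_starts_Suc: "starts y k (Suc t) \<Longrightarrow> fires y k (last_start y k t) (Suc t)"
  using last_start_le[of y k t] by (auto simp: starts_def split: if_splits)

lemma last_start_persists:
  assumes "starts y k s" "s \<le> t" "\<And>t'. t' \<le> t \<Longrightarrow> \<not> fires y k s t'"
  shows "last_start y k t = s"
  using assms(2,3)
proof (induction t rule: dec_induct)
  case base
  show ?case using assms(1) by (simp add: starts_def)
qed simp

lemma next_start:
  assumes "starts y k s" "fires y k s t"
  obtains t where "s \<le> t" "starts y k (Suc t)" "last_start y k t = s"
proof -
  define u where "u = (LEAST t. fires y k s t)"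
  have fires: "fires y k s u" and least: "\<And>t. t < u \<Longrightarrow> \<not> fires y k s t"
    unfolding u_def using assms(2) by (auto intro: LeastI dest: not_less_Least)
  then obtain t where t: "u = Suc t" "s \<le> t"
    unfolding fires_def by (cases u) auto
  have "last_start y k t = s"
    using assms(1) t least by (intro last_start_persists) auto
  moreover from this have "starts y k (Suc t)"
    using fires t by (simp add: starts_def)
  ultimately show ?thesis using that t by blast
qed

text \<open>
Cell 0 of column \<open>(k, s)\<close> is the marker: if an attempt starts there and is not the first one, it tells
whether the column of the attempt that has just fired was waiting. The other cells show column \<open>(k, s)\<close>
of \<open>x\<close>, without its leading ones if the column belongs to an attempt and waits.
\<close>

definition output_bit :: "cantor \<Rightarrow> cantor \<Rightarrow> nat \<Rightarrow> bool" where
  "output_bit x y n = (let k = pfst (pfst n); s = psnd (pfst n); i = psnd n in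
    if i = 0 then 0 < s \<and> starts y k s \<and> waits x k (last_start y k (s - 1))
    else if starts y k s \<and> waits x k s then x (cell k s (i - 1 + (k + 2)))
    else x (cell k s (i - 1)))"

lemma output_bit_cell:
  "output_bit x y (cell k s 0) \<longleftrightarrow> 0 < s \<and> starts y k s \<and> waits x k (last_start y k (s - 1))"
  "output_bit x y (cell k s (Suc i)) \<longleftrightarrow>
    (if starts y k s \<and> waits x k s then x (cell k s (i + (k + 2))) else x (cell k s i))"
  by (simp_all add: output_bit_def Let_def)

text \<open>
A cell of column \<open>(k, s)\<close> has a position of at least \<open>s\<close>, while the history up to stage \<open>s\<close> needs
only the bits below \<open>s\<close>.
\<close>

lemma output_bit_cong:
  assumes "\<And>i. i < n \<Longrightarrow> y i = y' i" shows "output_bit x y n = output_bit x y' n"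
proof -
  obtain k s i where n: "n = cell k s i" by (rule cell_cases)
  have s: "s \<le> n" by (simp add: n le_cell)
  have "starts y k s = starts y' k s" "last_start y k (s - 1) = last_start y' k (s - 1)"
    using s by (auto intro!: starts_cong last_start_cong assms)
  then show ?thesis
    by (cases i) (simp_all add: n output_bit_cell)
qed

text \<open>
The condition \<open>i < n\<close> makes the recursion well-founded; by locality it can be dropped afterwards, so
that \<open>encrypt x\<close> is the unique solution \<open>y\<close> of \<open>y n = output_bit x y n\<close>.
\<close>

function encrypt :: "cantor \<Rightarrow> nat \<Rightarrow> bool" where
  "encrypt x n = output_bit x (\<lambda>i. if i < n then encrypt x i else False) n"
  by auto
termination by lexicographic_order

declare encrypt.simps [simp del]

lemma encrypt_eq: "encrypt x n = output_bit x (encrypt x) n"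
  unfolding encrypt.simps[of x n] by (rule output_bit_cong) simp

lemma encrypt_eq_prefix_code:
  "encrypt x n = output_bit x (bit (prefix_code (encrypt x) n)) n"
  unfolding encrypt_eq[of x n] by (rule output_bit_cong) simp

lemma encrypt_unique:
  assumes "\<And>n. y n = output_bit x y n" shows "encrypt x = y"
proof
  fix n show "encrypt x n = y n"
  proof (induction n rule: less_induct)
    case (less n)
    then show ?case
      using encrypt_eq[of x n] assms[of n] output_bit_cong[of n "encrypt x" y x] by simp
  qed
qed

lemma encrypt_cell:
  "encrypt x (cell k s 0) \<longleftrightarrow>
    0 < s \<and> starts (encrypt x) k s \<and> waits x k (last_start (encrypt x) k (s - 1))"
  "encrypt x (cell k s (Suc i)) \<longleftrightarrow>
    (if starts (encrypt x) k s \<and> waits x k s then x (cell k s (i + (k + 2))) else x (cell k s i))"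
  using encrypt_eq output_bit_cell by blast+

text \<open>
A real leaves the domain exactly if one of its attempts has a waiting column and never fires.
\<close>

definition settled :: "cantor set" where
  "settled = {x. \<forall>k s. starts (encrypt x) k s \<and> waits x k s \<longrightarrow> (\<exists>t. fires (encrypt x) k s t)}"

lemma settledD:
  assumes "x \<in> settled" "starts (encrypt x) k s" "waits x k s"
  obtains t where "fires (encrypt x) k s t"
proof -
  have "\<exists>t. fires (encrypt x) k s t"
    using assms unfolding settled_def mem_Collect_eq by simp
  then show ?thesis using that by (elim exE)
qed

text \<open>
The output determines the attempts. For an attempt that fires, the marker of the next one reveals
whether its column waits; for one that never fires, membership in \<^const>\<open>settled\<close> does.
\<close>

lemma inj_on_encrypt: "inj_on encrypt settled"
proof (rule inj_onI)
  fix x x' assume x: "x \<in> settled" and x': "x' \<in> settled" and eq: "encrypt x = encrypt x'"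
  define y where "y = encrypt x"
  have y: "encrypt x = y" "encrypt x' = y"
    using eq y_def by auto
  have waits: "waits x k s = waits x' k s" if start: "starts y k s" for k s
  proof (cases "\<exists>t. fires y k s t")
    case True
    then obtain t where "starts y k (Suc t)" "last_start y k t = s"
      using start next_start by metis
    then show ?thesis
      using encrypt_cell(1)[of x k "Suc t"] encrypt_cell(1)[of x' k "Suc t"] y by simp
  next
    case False
    have "\<not> waits z k s" if "z \<in> settled" "encrypt z = y" for z
    proof
      assume "waits z k s"
      with that start obtain t where "fires y k s t"
        by (metis settledD)
      with False show False by (elim notE) (rule exI)
    qed
    with x x' y show ?thesis by simp
  qed
  show "x = x'"
  proof
    fix n
    obtain k s i where n: "n = cell k s i" by (rule cell_cases)
    show "x n = x' n"
    proof (cases "starts y k s \<and> waits x k s")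
      case True
      show ?thesis
      proof (cases "i < k + 2")
        case True
        then show ?thesis
          using \<open>starts y k s \<and> waits x k s\<close> waits unfolding n waits_def by blast
      next
        case False
        then obtain j where "i = j + (k + 2)"
          by (metis le_add_diff_inverse2 not_le)
        then show ?thesis
          using encrypt_cell(2)[of x k s j] encrypt_cell(2)[of x' k s j] y waits[of k s]
            \<open>starts y k s \<and> waits x k s\<close> n by simp
      qed
    next
      case False
      then have "\<not> (starts y k s \<and> waits x' k s)"
        using waits by blast
      with False show ?thesis
        using encrypt_cell(2)[of x k s i] encrypt_cell(2)[of x' k s i] y n by (simp only: if_False)
    qed
  qed
qed

text \<open>
Composition with \<open>skip k s m\<close> deletes the first \<open>m\<close> bits of column \<open>(k, s)\<close>.
\<close>

definition skip :: "nat \<Rightarrow> nat \<Rightarrow> nat \<Rightarrow> nat \<Rightarrow> nat" where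
  "skip k s m n = (if pfst n = prod_encode (k, s) then cell k s (psnd n + m) else n)"

lemma skip_cell:
  "skip k s m (cell k' s' i) = cell k' s' (if k' = k \<and> s' = s then i + m else i)"
  by (simp add: skip_def prod_encode_eq)

text \<open>
Without its leading ones the column no longer waits and is shown as it is, which is how it was shown
before. The markers that could tell the difference appear only after a firing.
\<close>

lemma encrypt_skip:
  assumes start: "starts (encrypt x) k s" and wait: "waits x k s"
    and silent: "\<And>t. \<not> fires (encrypt x) k s t"
  shows "encrypt (x \<circ> skip k s (k + 2)) = encrypt x"
proof (rule encrypt_unique)
  fix n
  obtain k' s' i where n: "n = cell k' s' i" by (rule cell_cases)
  have other: "waits (x \<circ> skip k s (k + 2)) k'' s'' = waits x k'' s''" if "\<not> (k'' = k \<and> s'' = s)" for k'' s''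
    using that by (auto simp: waits_def skip_cell)
  have self: "\<not> waits (x \<circ> skip k s (k + 2)) k s"
    using wait by (auto simp: waits_def skip_cell)
  show "encrypt x n = output_bit (x \<circ> skip k s (k + 2)) (encrypt x) n"
  proof (cases i)
    case 0
    have "last_start (encrypt x) k' (s' - 1) = s \<Longrightarrow> k' = k \<Longrightarrow> \<not> (0 < s' \<and> starts (encrypt x) k' s')"
      using fires_if_starts_Suc[of "encrypt x" k "s' - 1"] silent by auto
    then show ?thesis
      unfolding n 0 encrypt_cell output_bit_cell using other by blast
  next
    case (Suc j)
    show ?thesis
    proof (cases "k' = k \<and> s' = s")
      case True
      then show ?thesis
        using start wait self unfolding n Suc encrypt_cell output_bit_cell by (simp add: skip_cell)
    next
      case False
      then show ?thesis
        using other[OF False] unfolding n Suc encrypt_cell output_bit_cell by (simp add: skip_cell False)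
    qed
  qed
qed

text \<open>
The bits below \<open>s\<close> lie in columns of stages below \<open>s\<close>, and markers look back at earlier columns.
\<close>

lemma encrypt_local:
  assumes "\<And>k' s' i. s' < s \<Longrightarrow> x (cell k' s' i) = x' (cell k' s' i)" and "n < s"
  shows "encrypt x n = encrypt x' n"
  using assms(2)
proof (induction n rule: less_induct)
  case (less n)
  obtain k' s' i where n: "n = cell k' s' i" by (rule cell_cases)
  have s': "s' < s"
    using le_cell[of s' k' i] less.prems n by simp
  have waits: "waits x k'' s'' = waits x' k'' s''" if "s'' < s" for k'' s''
    using assms(1)[OF that] by (simp add: waits_def)
  have "last_start (encrypt x) k' (s' - 1) < s"
    using last_start_le[of "encrypt x" k' "s' - 1"] s' by simp
  then have "output_bit x (encrypt x) n = output_bit x' (encrypt x) n"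
    using waits s' assms(1)[OF s'] by (cases i) (simp_all add: n output_bit_cell)
  also have "\<dots> = output_bit x' (encrypt x') n"
    using less by (intro output_bit_cong) auto
  finally show ?case
    using encrypt_eq by blast
qed

section \<open>Partial computability\<close>

lemma computable_cell:
  assumes "computable K" "computable S" "computable I"
  shows "computable (\<lambda>x n. cell (K x n) (S x n) (I x n))"
  unfolding cell_def by (intro computable_intros assms)

lemma decidable_waits:
  assumes "computable K" "computable S"
  shows "decidable (\<lambda>x n. waits x (K x n) (S x n))"
  unfolding waits_def
  by (intro computable_cell computable_intros assms computable_compose[OF assms(1)]
    computable_compose[OF assms(2)])

lemma card_eq_sum_of_bool: "card {v. v < (m::nat) \<and> P v} = (\<Sum>v<m. of_bool (P v))"
  by (simp add: sum_of_bool_eq Collect_conj_eq lessThan_def)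

lemma decidable_fires:
  assumes "computable Y" "computable K" "computable S" "computable T"
  shows "decidable (\<lambda>x n. fires (bit (Y x n)) (K x n) (S x n) (T x n))"
proof -
  note assms' = assms assms[THEN computable_compose]
  show ?thesis
    unfolding fires_def correct_codes_def card_eq_sum_of_bool
    by (intro decidable_says decidable_join computable_cell computable_intros assms')
qed

lemma last_start_eq_rec:
  "last_start y k t = rec_nat 0 (\<lambda>i u. if fires y k u (Suc i) then Suc i else u) t"
  by (induction t) auto

lemma computable_last_start:
  assumes "computable Y" "computable K" "computable T"
  shows "computable (\<lambda>x n. last_start (bit (Y x n)) (K x n) (T x n))"
  unfolding last_start_eq_rec
  by (rule computable_rec_nat[where
      G="\<lambda>x i u n. if fires (bit (Y x n)) (K x n) u (Suc i) then Suc i else u"])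
     (intro decidable_fires computable_intros assms computable_compose[OF assms(1)]
       computable_compose[OF assms(2)])+

lemma decidable_starts:
  assumes "computable Y" "computable K" "computable S"
  shows "decidable (\<lambda>x n. starts (bit (Y x n)) (K x n) (S x n))"
  unfolding starts_def by (intro computable_last_start computable_intros assms)

lemma decidable_output_bit:
  assumes "computable Y" "computable N"
  shows "decidable (\<lambda>x n. output_bit x (bit (Y x n)) (N x n))"
  unfolding output_bit_def Let_def
  by (intro computable_last_start decidable_starts decidable_waits computable_cell
    computable_intros assms)

lemma computable_prefix_code_encrypt:
  assumes "computable N"
  shows "computable (\<lambda>x n. prefix_code (encrypt x) (N x n))"
proof -
  have "prefix_code (encrypt x) n =
      rec_nat 0 (\<lambda>i u. u + of_bool (output_bit x (bit u) i) * 2 ^ i) n" for x n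
  proof (induction n)
    case (Suc n)
    then show ?case
      by (simp add: prefix_code_Suc encrypt_eq_prefix_code[symmetric] flip: Suc)
  qed (simp add: prefix_code_0)
  moreover have "computable (\<lambda>x n.
      rec_nat 0 (\<lambda>i u. u + of_bool (output_bit x (bit u) i) * 2 ^ i) (N x n))"
    by (rule computable_rec_nat[where G="\<lambda>x i u n. u + of_bool (output_bit x (bit u) i) * 2 ^ i"])
       (intro decidable_output_bit computable_intros assms)+
  ultimately show ?thesis by simp
qed

lemma decidable_encrypt: "decidable encrypt"
proof -
  have "(\<lambda>x n. output_bit x (bit (prefix_code (encrypt x) n)) n) = encrypt"
    by (intro ext) (simp only: encrypt_eq_prefix_code[symmetric])
  moreover have "decidable (\<lambda>x n. output_bit x (bit (prefix_code (encrypt x) n)) n)"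
    by (intro decidable_output_bit computable_prefix_code_encrypt computable_intros)
  ultimately show ?thesis by (simp only:)
qed

text \<open>
For the domain to be exactly the set of reals on which all searches end, the \<open>n\<close>-th bit is
released only after the waiting attempts with indices up to \<open>n\<close> have fired.
\<close>

definition settled_by :: "cantor \<Rightarrow> nat \<Rightarrow> nat \<Rightarrow> bool" where
  "settled_by x t n \<longleftrightarrow> (\<forall>k<Suc n. \<forall>s<Suc n. starts (encrypt x) k s \<and> waits x k s \<longrightarrow>
    (\<exists>u<t. fires (encrypt x) k s u))"

lemma decidable_settled_by:
  "decidable (\<lambda>x m. settled_by x (pfst m) (psnd m))"
proof -
  have "starts (encrypt x) k s = starts (bit (prefix_code (encrypt x) s)) k s" for x k s
    by (rule starts_cong) simp
  moreover have "fires (encrypt x) k s t = fires (bit (prefix_code (encrypt x) t)) k s t" for x k s t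
    by (rule fires_cong) simp
  ultimately show ?thesis
    unfolding settled_by_def
    by (simp only:) (intro decidable_starts decidable_fires decidable_waits
      computable_prefix_code_encrypt computable_intros)
qed

lemma settled_iff: "x \<in> settled \<longleftrightarrow> (\<forall>n. \<exists>t. settled_by x t n)"
proof
  assume "x \<in> settled"
  then have "\<forall>k s. \<exists>t. starts (encrypt x) k s \<and> waits x k s \<longrightarrow> fires (encrypt x) k s t"
    unfolding settled_def by blast
  then obtain T where T: "\<And>k s. starts (encrypt x) k s \<Longrightarrow> waits x k s \<Longrightarrow> fires (encrypt x) k s (T k s)"
    by metis
  \<comment> \<open>a sum of the finitely many firing stages bounds each of them\<close>
  have "settled_by x (Suc (\<Sum>k\<le>n. \<Sum>s\<le>n. T k s)) n" for n
    unfolding settled_by_def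
  proof (intro allI impI)
    fix k s assume "k < Suc n" "s < Suc n" "starts (encrypt x) k s \<and> waits x k s"
    moreover have "T k s \<le> (\<Sum>s\<le>n. T k s)"
      by (rule member_le_sum) (use \<open>s < Suc n\<close> in auto)
    moreover have "(\<Sum>s\<le>n. T k s) \<le> (\<Sum>k\<le>n. \<Sum>s\<le>n. T k s)"
      by (rule member_le_sum[of k "{..n}" "\<lambda>k. \<Sum>s\<le>n. T k s"]) (use \<open>k < Suc n\<close> in auto)
    ultimately show "\<exists>u<Suc (\<Sum>k\<le>n. \<Sum>s\<le>n. T k s). fires (encrypt x) k s u"
      using T by (intro exI[of _ "T k s"]) auto
  qed
  then show "\<forall>n. \<exists>t. settled_by x t n" by blast
next
  assume *: "\<forall>n. \<exists>t. settled_by x t n"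
  show "x \<in> settled"
    unfolding settled_def
  proof (intro CollectI allI impI)
    fix k s assume "starts (encrypt x) k s \<and> waits x k s"
    moreover obtain t where "settled_by x t (k + s)" using * by blast
    ultimately show "\<exists>t. fires (encrypt x) k s t"
      unfolding settled_by_def by (meson le_add1 le_add2 less_Suc_eq_le)
  qed
qed

definition oneway :: "cantor \<rightharpoonup> cantor" where
  "oneway x = (if x \<in> settled then Some (encrypt x) else None)"

lemma dom_oneway [simp]: "dom oneway = settled"
  by (auto simp: oneway_def split: if_splits)

lemma partial_computable_oneway:
  assumes "settled \<noteq> {}" shows "partial_computable oneway"
proof -
  obtain \<Phi> where \<Phi>: "\<And>x n. computes x \<Phi> [n] (of_bool (encrypt x n))"
    using computableE[OF decidable_encrypt[unfolded decidable_def]] by blast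
  obtain \<Psi> where \<Psi>: "\<And>x t n. computes x \<Psi> [t, n] (of_bool (\<not> settled_by x t n))"
    using binary_program_of_computable[of "\<lambda>x t n. of_bool (\<not> settled_by x t n)"]
      decidable_not[OF decidable_settled_by] unfolding decidable_def by blast
  let ?\<Theta> = "Comp (Proj 0) [\<Phi>, Mu \<Psi>]"
  have out: "computes x ?\<Theta> [n] (of_bool (encrypt x n))" if "settled_by x t n" for x t n
  proof (rule computes_Comp2[OF \<Phi>])
    show "computes x (Mu \<Psi>) [n] (LEAST t. settled_by x t n)"
      using \<Psi> that by (rule computes_Mu)
  qed (simp add: computes_Proj)
  have halts: "\<exists>t. settled_by x t n" if "computes x ?\<Theta> [n] v" for x n v
  proof -
    from that obtain w where "computes x (Mu \<Psi>) [n] w"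
      by (rule computes_CompE) (auto simp: list_all2_Cons1)
    then have "computes x \<Psi> [w, n] 0"
      by (rule computes_MuE) simp
    with \<Psi>[of x w n] have "of_bool (\<not> settled_by x w n) = (0::nat)"
      by (rule computes_unique)
    then show ?thesis by auto
  qed
  have "x \<in> dom oneway \<longleftrightarrow> (\<forall>n. \<exists>v. computes x ?\<Theta> [n] v)" for x
    unfolding dom_oneway settled_iff using out halts by blast
  moreover have "computes x ?\<Theta> [n] (of_bool (the (oneway x) n))" if "x \<in> dom oneway" for x n
  proof -
    from that have x: "x \<in> settled" by simp
    then obtain t where "settled_by x t n"
      unfolding settled_iff by blast
    with x show ?thesis
      unfolding oneway_def using out by simp
  qed
  ultimately show ?thesis
    unfolding partial_computable_def using assms dom_oneway by blast
qed

section \<open>The uniform measure on Cantor space\<close>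

interpretation cantor: prob_space cantor_measure
  unfolding cantor_measure_def by (intro prob_space_PiM prob_space_uniform_count_measure) auto

interpretation coins: product_prob_space "\<lambda>_::nat. uniform_count_measure (UNIV :: bool set)" UNIV
proof -
  interpret prob_space "uniform_count_measure (UNIV :: bool set)"
    by (intro prob_space_uniform_count_measure) auto
  show "product_prob_space (\<lambda>_::nat. uniform_count_measure (UNIV :: bool set))"
    by unfold_locales
qed

lemma space_cantor_measure [simp]: "space cantor_measure = UNIV"
  by (simp add: cantor_measure_def space_PiM space_uniform_count_measure PiE_def)

lemma measurable_coin:
  "measurable N (uniform_count_measure (UNIV :: bool set)) = measurable N (count_space UNIV)"
  by (rule measurable_cong_sets) (simp_all add: sets_uniform_count_measure_count_space)

lemma measurable_coordinate [measurable]: "Measurable.pred cantor_measure (\<lambda>x. x i)"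
proof -
  have "(\<lambda>x. x i) \<in> measurable cantor_measure (uniform_count_measure UNIV)"
    unfolding cantor_measure_def by (rule measurable_component_singleton) simp
  then show ?thesis
    unfolding measurable_coin .
qed

lemma measurable_to_cantor:
  assumes "\<And>n. Measurable.pred N (\<lambda>x. f x n)" shows "f \<in> measurable N cantor_measure"
proof -
  have "(\<lambda>x. \<lambda>n. f x n) \<in> measurable N cantor_measure"
    unfolding cantor_measure_def
  proof (rule measurable_PiM_single')
    show "(\<lambda>x. f x n) \<in> measurable N (uniform_count_measure UNIV)" for n
      using assms[of n] unfolding measurable_coin .
  qed (simp add: space_uniform_count_measure PiE_def)
  then show ?thesis .
qed

lemma pred_fixed_bits: "Measurable.pred cantor_measure (\<lambda>x. \<forall>j\<in>J. x j = w j)"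
proof -
  have "Measurable.pred cantor_measure (\<lambda>x. x j = b)" for j b
    by (cases b) simp_all
  then show ?thesis
    by (intro pred_intros_countable_bounded(3))
qed

text \<open>
A predicate that looks at finitely many bits is a countable union of conditions on these bits.
\<close>

lemma pred_cantor_local:
  assumes "\<And>x x'. (\<And>i. i < n \<Longrightarrow> x i = x' i) \<Longrightarrow> P x = P x'"
  shows "Measurable.pred cantor_measure P"
proof -
  have code: "P x = P (bit (prefix_code x n))" for x
    by (rule assms) simp
  have local: "P x = P (bit v)" if "\<forall>i<n. x i = bit v i" for x and v :: nat
    by (rule assms) (use that in blast)
  have "P x \<longleftrightarrow> (\<exists>v\<in>{v::nat. P (bit v)}. \<forall>i\<in>{..<n}. x i = bit v i)" for x
  proof
    assume "P x"
    then have "prefix_code x n \<in> {v. P (bit v)}"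
      using code by blast
    then show "\<exists>v\<in>{v::nat. P (bit v)}. \<forall>i\<in>{..<n}. x i = bit v i"
      by (rule bexI[rotated]) simp
  next
    assume "\<exists>v\<in>{v::nat. P (bit v)}. \<forall>i\<in>{..<n}. x i = bit v i"
    then show "P x" using local by blast
  qed
  then have "P = (\<lambda>x. \<exists>v\<in>{v::nat. P (bit v)}. \<forall>i\<in>{..<n}. x i = bit v i)"
    by (rule ext)
  moreover have "Measurable.pred cantor_measure
      (\<lambda>x. \<exists>v\<in>{v::nat. P (bit v)}. \<forall>i\<in>{..<n}. x i = bit v i)"
    by (intro pred_intros_countable_bounded(4) pred_fixed_bits)
  ultimately show ?thesis
    by (rule ssubst[where P="Measurable.pred cantor_measure"])
qed

lemma sets_cantor_measure_Collect: "Measurable.pred cantor_measure P \<Longrightarrow> {x. P x} \<in> sets cantor_measure"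
  unfolding pred_def by simp

lemma pred_prefix_code [measurable]: "Measurable.pred cantor_measure (\<lambda>x. Q (prefix_code x n))"
proof (rule pred_cantor_local)
  fix x x' :: cantor assume "\<And>i. i < n \<Longrightarrow> x i = x' i"
  then have "map x [0..<n] = map x' [0..<n]"
    by (intro map_cong) auto
  then show "Q (prefix_code x n) = Q (prefix_code x' n)"
    by (simp only: prefix_code_def)
qed

lemma emeasure_fixed_bits:
  assumes "finite J"
  shows "emeasure cantor_measure {x. \<forall>j\<in>J. x j = w j} = (1 / 2) ^ card J"
proof -
  have half: "emeasure (uniform_count_measure UNIV) {b :: bool} = 1 / 2" for b
    by (simp add: emeasure_uniform_count_measure divide_ennreal_def)
  have "emeasure cantor_measure {x \<in> space cantor_measure. \<forall>j\<in>J. x j \<in> {w j}} =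
      (\<Prod>j\<in>J. emeasure (uniform_count_measure UNIV) {w j})"
    unfolding cantor_measure_def using assms
    by (intro coins.emeasure_PiM_Collect) (auto simp: sets_uniform_count_measure)
  then show ?thesis by (simp add: half)
qed

lemma emeasure_prefix_code:
  assumes "v < 2 ^ n" shows "emeasure cantor_measure {x. prefix_code x n = v} = (1 / 2) ^ n"
  using emeasure_fixed_bits[of "{..<n}" "bit v"] assms
  by (simp add: prefix_code_eq_iff Ball_def)

text \<open>
The initial segments of length \<open>n\<close> partition every set that is given by conditions on bits below \<open>n\<close>,
so it is enough to compare measures on cylinders.
\<close>

lemma cantor_measure_eqI:
  assumes M: "sets M = sets cantor_measure" and N: "sets N = sets cantor_measure"
    and fin: "finite_measure M"
    and eq: "\<And>n v. v < 2 ^ n \<Longrightarrow> emeasure M {x. prefix_code x n = v} = emeasure N {x. prefix_code x n = v}"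
  shows "M = N"
proof (rule measure_eqI_PiM_infinite[OF M[unfolded cantor_measure_def] N[unfolded cantor_measure_def] _ fin])
  fix A :: "nat \<Rightarrow> bool set" and J :: "nat set"
  assume "finite J"
  then obtain n where n: "\<forall>j\<in>J. j < n"
    unfolding finite_nat_set_iff_bounded by (elim exE)
  define V where "V = {v :: nat. v < 2 ^ n \<and> (\<forall>j\<in>J. bit v j \<in> A j)}"
  have "prod_emb UNIV (\<lambda>_. uniform_count_measure UNIV) J (Pi\<^sub>E J A) = {x. \<forall>j\<in>J. x j \<in> A j}"
    by (auto simp: prod_emb_def space_uniform_count_measure Pi_iff restrict_PiE_iff)
  also have "\<dots> = (\<Union>v\<in>V. {x. prefix_code x n = v})"
    using n prefix_code_less unfolding V_def by auto
  finally have emb: "prod_emb UNIV (\<lambda>_. uniform_count_measure UNIV) J (Pi\<^sub>E J A) =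
      (\<Union>v\<in>V. {x. prefix_code x n = v})" .
  have V: "finite V" by (simp add: V_def)
  have disj: "disjoint_family_on (\<lambda>v. {x. prefix_code x n = v}) V"
    by (auto simp: disjoint_family_on_def)
  have sets: "(\<lambda>v. {x. prefix_code x n = v}) ` V \<subseteq> sets cantor_measure"
    by (auto intro: sets_cantor_measure_Collect)
  have "(\<Sum>v\<in>V. emeasure M {x. prefix_code x n = v}) = (\<Sum>v\<in>V. emeasure N {x. prefix_code x n = v})"
    by (intro sum.cong eq) (auto simp: V_def)
  then show "emeasure M (prod_emb UNIV (\<lambda>_. uniform_count_measure UNIV) J (Pi\<^sub>E J A)) =
      emeasure N (prod_emb UNIV (\<lambda>_. uniform_count_measure UNIV) J (Pi\<^sub>E J A))"
    unfolding emb using sum_emeasure[OF _ disj V, of M] sum_emeasure[OF _ disj V, of N] sets M N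
    by simp
qed

text \<open>
The bits in \<open>P\<close> are independent of those in the range of \<open>h\<close>, and reading the latter in the order given by
\<open>h\<close> yields a uniformly distributed real. Both sides are finite measures in \<open>A\<close> that agree on cylinders.
\<close>

lemma emeasure_fixed_bits_reindex:
  fixes h :: "nat \<Rightarrow> nat"
  assumes h: "inj h" and P: "finite P" "P \<inter> range h = {}" and A: "A \<in> sets cantor_measure"
  shows "emeasure cantor_measure {x. (\<forall>p\<in>P. x p = w p) \<and> x \<circ> h \<in> A} =
    (1 / 2) ^ card P * emeasure cantor_measure A"
proof -
  define E where "E = {x :: cantor. \<forall>p\<in>P. x p = w p}"
  have h_meas [measurable]: "(\<lambda>x. x \<circ> h) \<in> measurable cantor_measure cantor_measure"
    by (rule measurable_to_cantor) simp
  have E [measurable]: "E \<in> sets cantor_measure"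
    unfolding E_def by (intro sets_cantor_measure_Collect pred_fixed_bits)
  let ?M = "distr (density cantor_measure (indicator E)) cantor_measure (\<lambda>x. x \<circ> h)"
  let ?N = "scale_measure ((1 / 2) ^ card P) cantor_measure"
  have M: "emeasure ?M B = emeasure cantor_measure (E \<inter> {x. x \<circ> h \<in> B})"
    if "B \<in> sets cantor_measure" for B
  proof -
    have "{x. x \<circ> h \<in> B} \<in> sets cantor_measure"
      using measurable_sets[OF h_meas that] by (simp add: vimage_def)
    with that show ?thesis
      by (simp add: emeasure_distr emeasure_restricted vimage_def)
  qed
  have "?M = ?N"
  proof (rule cantor_measure_eqI)
    show "finite_measure ?M"
    proof (rule finite_measureI)
      show "emeasure ?M (space ?M) \<noteq> \<infinity>"
        using M[of UNIV] sets.top[of cantor_measure] by (simp add: cantor.emeasure_eq_measure)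
    qed
  next
    fix n v :: nat assume v: "v < 2 ^ n"
    let ?J = "P \<union> h ` {..<n}"
    let ?w = "\<lambda>j. if j \<in> P then w j else bit v (inv h j)"
    have "h i \<notin> P" for i using P(2) by blast
    then have "E \<inter> {x. x \<circ> h \<in> {x. prefix_code x n = v}} = {x. \<forall>j\<in>?J. x j = ?w j}"
      using h by (auto simp: E_def prefix_code_eq_iff[OF v])
    moreover have "card ?J = card P + n"
      using P inj_on_subset[OF h] by (subst card_Un_disjoint) (auto simp: card_image)
    ultimately show "emeasure ?M {x. prefix_code x n = v} = emeasure ?N {x. prefix_code x n = v}"
      using emeasure_fixed_bits[of ?J ?w] P(1)
      by (simp add: M sets_cantor_measure_Collect emeasure_prefix_code[OF v] power_add)
  qed simp_all
  then have "emeasure ?M A = emeasure ?N A" by simp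
  then show ?thesis
    unfolding M[OF A] by (simp add: E_def Collect_conj_eq)
qed

lemma measurable_join [measurable]:
  "(\<lambda>(x, r). x \<squnion>\<squnion> r) \<in> measurable (cantor_measure \<Otimes>\<^sub>M cantor_measure) cantor_measure"
  by (rule measurable_to_cantor) (simp add: join_def split_beta)

text \<open>
A condition on the first \<open>n\<close> bits of a join splits into conditions on its even and its odd positions,
which are \<open>n\<close> positions altogether.
\<close>

lemma distr_join:
  "distr (cantor_measure \<Otimes>\<^sub>M cantor_measure) cantor_measure (\<lambda>(x, r). x \<squnion>\<squnion> r) = cantor_measure"
proof -
  interpret pair: pair_prob_space cantor_measure cantor_measure ..
  show ?thesis
  proof (rule cantor_measure_eqI)
    show "finite_measure (distr (cantor_measure \<Otimes>\<^sub>M cantor_measure) cantor_measure (\<lambda>(x, r). x \<squnion>\<squnion> r))"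
      by (intro prob_space.finite_measure pair.prob_space_distr) simp
  next
    fix n v :: nat assume v: "v < 2 ^ n"
    let ?I = "{i. 2 * i < n}" and ?J = "{i. 2 * i + 1 < n}"
    let ?X = "{x. \<forall>i\<in>?I. x i = bit v (2 * i)}" and ?Y = "{r. \<forall>i\<in>?J. r i = bit v (2 * i + 1)}"
    have fin: "finite ?I" "finite ?J"
      by (rule finite_subset[of _ "{..n}"]; auto)+
    have iff: "prefix_code (x \<squnion>\<squnion> r) n = v \<longleftrightarrow>
        (\<forall>i\<in>?I. x i = bit v (2 * i)) \<and> (\<forall>i\<in>?J. r i = bit v (2 * i + 1))" for x r
    proof -
      have "(\<forall>i<n. P i) \<longleftrightarrow> (\<forall>i\<in>?I. P (2 * i)) \<and> (\<forall>i\<in>?J. P (2 * i + 1))" for P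
      proof
        assume P: "(\<forall>i\<in>?I. P (2 * i)) \<and> (\<forall>i\<in>?J. P (2 * i + 1))"
        show "\<forall>i<n. P i"
        proof (intro allI impI)
          fix i assume "i < n"
          moreover have "i = 2 * (i div 2) \<or> i = 2 * (i div 2) + 1"
            by presburger
          ultimately show "P i"
            using P by (metis mem_Collect_eq)
        qed
      qed auto
      from this[of "\<lambda>i. (x \<squnion>\<squnion> r) i = bit v i"] show ?thesis
        unfolding prefix_code_eq_iff[OF v] join_even_odd .
    qed
    have "z \<in> (\<lambda>(x, r). x \<squnion>\<squnion> r) -` {x. prefix_code x n = v} \<longleftrightarrow>
        z \<in> ?X \<times> ?Y" for z
      by (cases z) (simp only: vimage_eq prod.case mem_Collect_eq[of _ "\<lambda>x. prefix_code x n = v"]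
        mem_Times_iff fst_conv snd_conv iff mem_Collect_eq)
    then have vimage: "(\<lambda>(x, r). x \<squnion>\<squnion> r) -` {x. prefix_code x n = v} = ?X \<times> ?Y"
      by (rule set_eqI)
    have sets: "{x. \<forall>i\<in>K. x i = w i} \<in> sets cantor_measure" for K and w :: cantor
      by (intro sets_cantor_measure_Collect pred_fixed_bits)
    have card: "card ?I + card ?J = n"
    proof -
      have "n = card ((\<lambda>i. 2 * i) ` ?I \<union> (\<lambda>i. 2 * i + 1) ` ?J)"
      proof -
        have "(\<lambda>i. 2 * i) ` ?I \<union> (\<lambda>i. 2 * i + 1) ` ?J = {..<n}"
        proof
          show "{..<n} \<subseteq> (\<lambda>i. 2 * i) ` ?I \<union> (\<lambda>i. 2 * i + 1) ` ?J"
          proof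
            fix i assume i: "i \<in> {..<n}"
            show "i \<in> (\<lambda>i. 2 * i) ` ?I \<union> (\<lambda>i. 2 * i + 1) ` ?J"
            proof (cases "even i")
              case True
              with i have "i div 2 \<in> ?I" "i = 2 * (i div 2)" by simp_all
              then show ?thesis by blast
            next
              case False
              with i have "i div 2 \<in> ?J" "i = 2 * (i div 2) + 1" by simp_all
              then show ?thesis by blast
            qed
          qed
        qed auto
        then show ?thesis by simp
      qed
      also have "\<dots> = card ((\<lambda>i. 2 * i) ` ?I) + card ((\<lambda>i. 2 * i + 1) ` ?J)"
        using fin by (intro card_Un_disjoint) (auto, presburger)
      finally show ?thesis
        by (simp add: card_image inj_on_def)
    qed
    have "emeasure (distr (cantor_measure \<Otimes>\<^sub>M cantor_measure) cantor_measure
        (\<lambda>(x, r). x \<squnion>\<squnion> r)) {x. prefix_code x n = v} =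
        emeasure (cantor_measure \<Otimes>\<^sub>M cantor_measure) (?X \<times> ?Y)"
      using emeasure_distr[OF measurable_join
          sets_cantor_measure_Collect[OF pred_prefix_code[of "\<lambda>c. c = v" n]]]
      unfolding vimage space_pair_measure space_cantor_measure UNIV_Times_UNIV Int_UNIV_right .
    also have "\<dots> = emeasure cantor_measure ?X * emeasure cantor_measure ?Y"
      by (rule cantor.emeasure_pair_measure_Times) (rule sets)+
    also have "\<dots> = (1 / 2) ^ (card ?I + card ?J)"
      unfolding emeasure_fixed_bits[OF fin(1)] emeasure_fixed_bits[OF fin(2)] power_add ..
    finally show "emeasure (distr (cantor_measure \<Otimes>\<^sub>M cantor_measure) cantor_measure
        (\<lambda>(x, r). x \<squnion>\<squnion> r)) {x. prefix_code x n = v} = emeasure cantor_measure {x. prefix_code x n = v}"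
      unfolding card emeasure_prefix_code[OF v] .
  qed simp_all
qed

section \<open>Density in cylinders\<close>

text \<open>
These are the sets that are both open and closed in the product topology: those decided by an initial
segment.
\<close>

definition clopen :: "cantor set \<Rightarrow> bool" where
  "clopen C \<longleftrightarrow> (\<exists>n Q. C = {x. Q (prefix_code x n)})"

lemma clopenI: "clopen {x. Q (prefix_code x n)}"
  unfolding clopen_def by blast

lemma clopen_sets: "clopen C \<Longrightarrow> C \<in> sets cantor_measure"
  unfolding clopen_def using sets_cantor_measure_Collect[OF pred_prefix_code] by (elim exE) simp

lemma clopen_Compl: assumes "clopen C" shows "clopen (- C)"
proof -
  obtain n Q where "C = {x. Q (prefix_code x n)}"
    using assms unfolding clopen_def by (elim exE)
  then have "- C = {x. \<not> Q (prefix_code x n)}" by auto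
  then show ?thesis
    using clopenI[of "\<lambda>c. \<not> Q c" n] by simp
qed

lemma clopen_Un: assumes "clopen C" "clopen D" shows "clopen (C \<union> D)"
proof -
  obtain m P n Q where C: "C = {x. P (prefix_code x m)}" and D: "D = {x. Q (prefix_code x n)}"
    using assms unfolding clopen_def by (elim exE)
  have "prefix_code x m = prefix_code x (max m n) mod 2 ^ m"
    "prefix_code x n = prefix_code x (max m n) mod 2 ^ n" for x
    by (simp_all add: prefix_code_mod)
  then have "C \<union> D = {x. (\<lambda>c. P (c mod 2 ^ m) \<or> Q (c mod 2 ^ n)) (prefix_code x (max m n))}"
    unfolding C D by simp (simp add: Collect_disj_eq)
  then show ?thesis
    using clopenI[of "\<lambda>c. P (c mod 2 ^ m) \<or> Q (c mod 2 ^ n)"] by simp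
qed

lemma clopen_UN: "clopen (\<Union>i<N. C i)" if "\<And>i. clopen (C i)" for N :: nat
proof (induction N)
  case 0
  show ?case
    using clopenI[of "\<lambda>_. False" 0] by simp
next
  case (Suc N)
  then show ?case using clopen_Un that by (simp add: lessThan_Suc)
qed

text \<open>
The sets that can be approximated form a \<open>\<sigma>\<close>-algebra. For a countable union, all but finitely many
members are dropped first, and then each remaining member is approximated.
\<close>

lemma clopen_approx:
  assumes "A \<in> sets cantor_measure" "0 < e"
  obtains C where "clopen C" "cantor.prob (sym_diff A C) < e"
proof -
  let ?G = "{{f \<in> (UNIV :: cantor set). f i \<in> B} | i B. B \<in> (UNIV :: bool set set)}"
  have "sets cantor_measure = sigma_sets UNIV ?G"
    unfolding cantor_measure_def sets_PiM_single
    by (simp add: space_uniform_count_measure sets_uniform_count_measure)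
  with assms(1) have "A \<in> sigma_sets UNIV ?G" by simp
  then have "\<forall>e>0. \<exists>C. clopen C \<and> cantor.prob (sym_diff A C) < e"
  proof induction
    case (Basic A)
    then obtain i B where A: "A = {f. f i \<in> B}" by auto
    have "A = {x. (\<lambda>c. bit c i \<in> B) (prefix_code x (Suc i))}" unfolding A by simp
    then have "clopen A"
      using clopenI[of "\<lambda>c. bit c i \<in> B" "Suc i"] by simp
    then show ?case by (auto intro!: exI[of _ A])
  next
    case Empty
    have "clopen {}"
      using clopenI[of "\<lambda>_. False" 0] by simp
    then show ?case by (auto intro!: exI[of _ "{}"])
  next
    case (Compl A)
    show ?case
    proof (intro allI impI)
      fix e :: real assume "0 < e"
      with Compl.IH obtain C where "clopen C" "cantor.prob (sym_diff A C) < e" by blast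
      moreover have "sym_diff (UNIV - A) (- C) = sym_diff A C" by auto
      ultimately show "\<exists>C. clopen C \<and> cantor.prob (sym_diff (UNIV - A) C) < e"
        using clopen_Compl by metis
    qed
  next
    case (Union A)
    have A: "A i \<in> sets cantor_measure" for i
      using Union.hyps[of i] \<open>sets cantor_measure = sigma_sets UNIV ?G\<close> by simp
    show ?case
    proof (intro allI impI)
      fix e :: real assume e: "0 < e"
      let ?B = "\<lambda>N. \<Union>i<N. A i"
      have "(\<lambda>N. cantor.prob (?B N)) \<longlonglongrightarrow> cantor.prob (\<Union>N. ?B N)"
        using A by (intro cantor.finite_Lim_measure_incseq) (auto simp: incseq_def intro: less_le_trans)
      moreover have "(\<Union>N. ?B N) = (\<Union>i. A i)" by auto
      ultimately have "(\<lambda>N. cantor.prob (?B N)) \<longlonglongrightarrow> cantor.prob (\<Union>i. A i)" by simp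
      \<comment> \<open>the tail of the union and the approximation errors get half of the tolerance each\<close>
      from LIMSEQ_D[OF this, of "e / 2"] e obtain N where
        "norm (cantor.prob (?B N) - cantor.prob (\<Union>i. A i)) < e / 2" by auto
      moreover have "cantor.prob ((\<Union>i. A i) - ?B N) = cantor.prob (\<Union>i. A i) - cantor.prob (?B N)"
        using A by (intro cantor.finite_measure_Diff) auto
      ultimately have rest: "cantor.prob ((\<Union>i. A i) - ?B N) < e / 2" by (simp add: abs_if split: if_splits)
      have "\<forall>i. \<exists>C. clopen C \<and> cantor.prob (sym_diff (A i) C) < e / (2 * Suc N)"
        using Union.IH e by simp
      then obtain C where C: "\<And>i. clopen (C i)"
        "\<And>i. cantor.prob (sym_diff (A i) (C i)) < e / (2 * Suc N)"
        by metis
      have sets: "sym_diff (A i) (C i) \<in> sets cantor_measure" for i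
        using A clopen_sets[OF C(1)] by auto
      have "sym_diff (\<Union>i. A i) (\<Union>i<N. C i) \<subseteq>
          ((\<Union>i. A i) - ?B N) \<union> (\<Union>i<N. sym_diff (A i) (C i))" by auto
      then have "cantor.prob (sym_diff (\<Union>i. A i) (\<Union>i<N. C i)) \<le>
          cantor.prob (((\<Union>i. A i) - ?B N) \<union> (\<Union>i<N. sym_diff (A i) (C i)))"
        using A sets by (intro cantor.finite_measure_mono) auto
      also have "\<dots> \<le> cantor.prob ((\<Union>i. A i) - ?B N) + cantor.prob (\<Union>i<N. sym_diff (A i) (C i))"
        using A sets by (intro measure_Un_le) auto
      also have "cantor.prob (\<Union>i<N. sym_diff (A i) (C i)) \<le> (\<Sum>i<N. cantor.prob (sym_diff (A i) (C i)))"
        using sets by (intro cantor.finite_measure_subadditive_finite) auto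
      also have "\<dots> \<le> (\<Sum>i<N. e / (2 * Suc N))"
        using C(2) by (intro sum_mono less_imp_le)
      also have "\<dots> \<le> e / 2"
        using e by (simp add: field_simps)
      finally have "cantor.prob (sym_diff (\<Union>i. A i) (\<Union>i<N. C i)) < e"
        using rest by simp
      then show "\<exists>C. clopen C \<and> cantor.prob (sym_diff (\<Union>i. A i) C) < e"
        using clopen_UN[of C N] C(1) by blast
    qed
  qed
  with assms(2) that show ?thesis by blast
qed

lemma ennreal_half_power: "(1 / 2 :: ennreal) ^ n = ennreal (1 / 2 ^ n)"
proof -
  have "(1 / 2 :: ennreal) = ennreal (1 / 2)"
    by (simp add: divide_ennreal_def)
  then show ?thesis
    by (simp only: ennreal_power) (simp add: power_one_over)
qed

lemma prob_prefix_code: "v < 2 ^ n \<Longrightarrow> cantor.prob {x. prefix_code x n = v} = 1 / 2 ^ n"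
  using emeasure_prefix_code[of v n]
  unfolding ennreal_half_power cantor.emeasure_eq_measure by simp

lemma prob_prefix_code_in:
  assumes A: "A \<in> sets cantor_measure" and V: "V \<subseteq> {..<2 ^ n}"
  shows "cantor.prob (A \<inter> {x. prefix_code x n \<in> V}) =
    (\<Sum>v\<in>V. cantor.prob (A \<inter> {x. prefix_code x n = v}))"
proof -
  have "A \<inter> {x. prefix_code x n \<in> V} = (\<Union>v\<in>V. A \<inter> {x. prefix_code x n = v})" by auto
  moreover have "cantor.prob (\<Union>v\<in>V. A \<inter> {x. prefix_code x n = v}) =
      (\<Sum>v\<in>V. cantor.prob (A \<inter> {x. prefix_code x n = v}))"
    using A finite_subset[OF V]
    by (intro cantor.finite_measure_finite_Union)
       (auto simp: disjoint_family_on_def intro!: sets.Int sets_cantor_measure_Collect)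
  ultimately show ?thesis by simp
qed

lemma prob_prefix_code_card:
  assumes V: "V \<subseteq> {..<2 ^ n}" shows "cantor.prob {x. prefix_code x n \<in> V} = card V / 2 ^ n"
proof -
  have "cantor.prob {x. prefix_code x n \<in> V} = (\<Sum>v\<in>V. cantor.prob {x. prefix_code x n = v})"
    using prob_prefix_code_in[OF sets.top V] by simp
  also have "\<dots> = (\<Sum>v\<in>V. 1 / 2 ^ n)"
    using V by (intro sum.cong prob_prefix_code) auto
  finally show ?thesis by simp
qed

text \<open>
A weak form of Lebesgue's density theorem. If \<open>S\<close> filled at most half of each cylinder, it would fill at
most half of each clopen set, also of one that differs from \<open>S\<close> by less than a quarter of its measure.
\<close>

lemma dense_cylinder:
  assumes S: "S \<in> sets cantor_measure" "0 < cantor.prob S"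
  obtains n v where "v < 2 ^ n" "1 / 2 ^ n < 2 * cantor.prob (S \<inter> {x. prefix_code x n = v})"
proof (rule ccontr)
  assume "\<not> thesis"
  with that have thin: "2 * cantor.prob (S \<inter> {x. prefix_code x n = v}) \<le> 1 / 2 ^ n"
    if "v < 2 ^ n" for n v
    using that by (meson not_less)
  \<comment> \<open>a tolerance below a third of the measure is what the final estimate needs\<close>
  obtain C where C: "clopen C" "cantor.prob (sym_diff S C) < cantor.prob S / 4"
    using clopen_approx[OF S(1), of "cantor.prob S / 4"] S(2) by auto
  obtain n Q where Q: "C = {x. Q (prefix_code x n)}"
    using C(1) unfolding clopen_def by (elim exE)
  define V where "V = {v. v < 2 ^ n \<and> Q v}"
  have V: "V \<subseteq> {..<2 ^ n}" by (auto simp: V_def)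
  have CV: "C = {x. prefix_code x n \<in> V}"
    using prefix_code_less by (auto simp: Q V_def)
  have C_sets: "C \<in> sets cantor_measure" by (rule clopen_sets[OF C(1)])
  have "2 * cantor.prob (S \<inter> C) = (\<Sum>v\<in>V. 2 * cantor.prob (S \<inter> {x. prefix_code x n = v}))"
    unfolding CV prob_prefix_code_in[OF S(1) V] sum_distrib_left ..
  also have "\<dots> \<le> (\<Sum>v\<in>V. 1 / 2 ^ n)"
    using V by (intro sum_mono thin) auto
  also have "\<dots> = cantor.prob C"
    unfolding CV prob_prefix_code_card[OF V] by simp
  finally have half: "2 * cantor.prob (S \<inter> C) \<le> cantor.prob C" .
  have "cantor.prob S \<le> cantor.prob (S \<inter> C) + cantor.prob (sym_diff S C)"
    using S(1) C_sets
    by (intro order_trans[OF cantor.finite_measure_mono measure_Un_le]) auto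
  moreover have "cantor.prob C \<le> cantor.prob S + cantor.prob (sym_diff S C)"
    using S(1) C_sets
    by (intro order_trans[OF cantor.finite_measure_mono measure_Un_le]) auto
  ultimately show False
    using half C(2) S(2) by linarith
qed

section \<open>Measurability of the construction\<close>

lemma pred_starts: "Measurable.pred cantor_measure (\<lambda>y. starts y k s)"
  by (rule pred_cantor_local[of s]) (rule starts_cong)

lemma pred_fires: "Measurable.pred cantor_measure (\<lambda>y. fires y k s t)"
  by (rule pred_cantor_local[of t]) (rule fires_cong)

lemma pred_waits [measurable]: "Measurable.pred cantor_measure (\<lambda>x. waits x k s)"
  unfolding waits_def by simp

lemma pred_computes: "Measurable.pred cantor_measure (\<lambda>z. computes z \<Phi> [p] (of_bool b))"
proof -
  have "Measurable.pred cantor_measure (\<lambda>z. says z u c e p b)" for u c e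
    by (rule pred_cantor_local[of u]) (rule says_cong)
  then show ?thesis
    unfolding computes_iff_says by (intro pred_intros_countable(2))
qed

lemma pred_output_bit: "Measurable.pred cantor_measure (\<lambda>x. output_bit x y n)"
  unfolding output_bit_def Let_def by simp

text \<open>
By induction on the position: an output bit is a function of the earlier output, of which there are
finitely many possibilities, and of finitely many bits of \<open>x\<close>.
\<close>

lemma measurable_encrypt [measurable]: "encrypt \<in> measurable cantor_measure cantor_measure"
proof (rule measurable_to_cantor)
  show "Measurable.pred cantor_measure (\<lambda>x. encrypt x n)" for n
  proof (induction n rule: less_induct)
    case (less n)
    have "encrypt x n \<longleftrightarrow> (\<exists>v\<in>{..<2 ^ n :: nat}. (\<forall>i\<in>{..<n}. encrypt x i = bit v i) \<and> output_bit x (bit v) n)" for x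
    proof
      assume "encrypt x n"
      then have "output_bit x (bit (prefix_code (encrypt x) n)) n"
        using encrypt_eq_prefix_code by blast
      then show "\<exists>v\<in>{..<2 ^ n :: nat}. (\<forall>i\<in>{..<n}. encrypt x i = bit v i) \<and> output_bit x (bit v) n"
        using prefix_code_less by (intro bexI[of _ "prefix_code (encrypt x) n"]) auto
    next
      assume "\<exists>v\<in>{..<2 ^ n :: nat}. (\<forall>i\<in>{..<n}. encrypt x i = bit v i) \<and> output_bit x (bit v) n"
      then obtain v :: nat where "\<And>i. i < n \<Longrightarrow> bit v i = encrypt x i" "output_bit x (bit v) n"
        by (metis lessThan_iff)
      then have "output_bit x (encrypt x) n"
        using output_bit_cong[of n "bit v" "encrypt x" x] by blast
      then show "encrypt x n" using encrypt_eq by blast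
    qed
    then have "(\<lambda>x. encrypt x n) =
        (\<lambda>x. \<exists>v\<in>{..<2 ^ n :: nat}. (\<forall>i\<in>{..<n}. encrypt x i = bit v i) \<and> output_bit x (bit v) n)"
      by (rule ext)
    moreover have "Measurable.pred cantor_measure (\<lambda>x. encrypt x i = b)" if "i < n" for i b
      using less[OF that] by (cases b) simp_all
    then have "Measurable.pred cantor_measure
        (\<lambda>x. \<exists>v\<in>{..<2 ^ n :: nat}. (\<forall>i\<in>{..<n}. encrypt x i = bit v i) \<and> output_bit x (bit v) n)"
      by (intro pred_intros_countable_bounded(3,4) pred_intros_logic(3) pred_output_bit) simp
    ultimately show ?case
      by (rule ssubst[where P="Measurable.pred cantor_measure"])
  qed
qed

lemmas pred_starts_encrypt [measurable] = measurable_compose[OF measurable_encrypt pred_starts]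
lemmas pred_fires_encrypt [measurable] = measurable_compose[OF measurable_encrypt pred_fires]

lemma sets_settled [measurable]: "settled \<in> sets cantor_measure"
  unfolding settled_def by (rule sets_cantor_measure_Collect) measurable

section \<open>The domain has positive measure\<close>

lemma inj_skip: "inj (skip k s m)"
proof (rule injI)
  fix a b assume eq: "skip k s m a = skip k s m b"
  obtain k1 s1 i1 where a: "a = cell k1 s1 i1" by (rule cell_cases)
  obtain k2 s2 i2 where b: "b = cell k2 s2 i2" by (rule cell_cases)
  show "a = b"
    using eq unfolding a b by (auto simp: skip_cell split: if_splits)
qed

text \<open>
For \<open>A\<close> that does not look at column \<open>(k, s)\<close> this expresses independence of the column; in general
it compares \<open>A\<close> with its preimage under the deletion of a fixed beginning of the column.
\<close>

lemma emeasure_column_start_skip: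
  assumes "A \<in> sets cantor_measure"
  shows "emeasure cantor_measure {x. (\<forall>i<m. x (cell k s i) = w i) \<and> x \<circ> skip k s m \<in> A} =
    ennreal (1 / 2 ^ m) * emeasure cantor_measure A"
proof -
  let ?P = "cell k s ` {..<m}"
  have "cell k s i \<notin> range (skip k s m)" if "i < m" for i
  proof
    assume "cell k s i \<in> range (skip k s m)"
    then obtain n where n: "cell k s i = skip k s m n" by blast
    obtain k' s' i' where "n = cell k' s' i'" by (rule cell_cases)
    with n that show False by (auto simp: skip_cell split: if_splits)
  qed
  then have "?P \<inter> range (skip k s m) = {}" by blast
  moreover have "card ?P = m" by (simp add: card_image inj_on_def)
  moreover have "(\<forall>p\<in>?P. x p = w (psnd p)) \<longleftrightarrow> (\<forall>i<m. x (cell k s i) = w i)" for x :: cantor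
    by auto
  ultimately show ?thesis
    using emeasure_fixed_bits_reindex[OF inj_skip _ _ assms, of ?P k s m "\<lambda>p. w (psnd p)"]
    by (simp only: ennreal_half_power finite_imageI finite_lessThan simp_thms)
qed

text \<open>
The requirement \<open>k\<close> makes its last attempt at stage \<open>s\<close>.
\<close>

definition silent :: "nat \<Rightarrow> nat \<Rightarrow> cantor set" where
  "silent k s = {x. starts (encrypt x) k s \<and> (\<forall>t. \<not> fires (encrypt x) k s t)}"

lemma sets_silent: "silent k s \<in> sets cantor_measure"
  unfolding silent_def by (rule sets_cantor_measure_Collect) measurable

lemma disjoint_silent: "disjoint_family (silent k)"
proof -
  have "\<not> (s < s' \<and> x \<in> silent k s \<and> x \<in> silent k s')" for x s s'
    using last_start_persists[of "encrypt x" k s s'] by (auto simp: silent_def starts_def)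
  then have "s = s'" if "x \<in> silent k s" "x \<in> silent k s'" for x s s'
    using that by (meson linorder_neqE_nat)
  then show ?thesis
    unfolding disjoint_family_on_def by blast
qed

text \<open>
Deleting the \<open>k + 2\<close> leading ones sends these reals into \<open>silent k s\<close>, because the output does not
change.
\<close>

lemma emeasure_silent_waits:
  "emeasure cantor_measure {x \<in> silent k s. waits x k s} \<le>
    ennreal (1 / 2 ^ (k + 2)) * emeasure cantor_measure (silent k s)"
proof -
  let ?E = "{x. (\<forall>i<k + 2. x (cell k s i) = True) \<and> x \<circ> skip k s (k + 2) \<in> silent k s}"
  have "(\<lambda>x. x \<circ> skip k s (k + 2)) \<in> measurable cantor_measure cantor_measure"
    by (rule measurable_to_cantor) simp
  then have "(\<lambda>x. x \<circ> skip k s (k + 2)) -` silent k s \<in> sets cantor_measure"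
    using measurable_sets[OF _ sets_silent, of _ cantor_measure k s] by simp
  moreover have "{x. \<forall>j\<in>cell k s ` {..<k + 2}. x j = True} \<in> sets cantor_measure"
    by (intro sets_cantor_measure_Collect pred_fixed_bits)
  ultimately have "{x. \<forall>j\<in>cell k s ` {..<k + 2}. x j = True} \<inter>
      (\<lambda>x. x \<circ> skip k s (k + 2)) -` silent k s \<in> sets cantor_measure"
    by blast
  also have "{x. \<forall>j\<in>cell k s ` {..<k + 2}. x j = True} \<inter>
      (\<lambda>x. x \<circ> skip k s (k + 2)) -` silent k s = ?E"
    by auto
  finally have E: "?E \<in> sets cantor_measure" .
  have "{x \<in> silent k s. waits x k s} \<subseteq> ?E"
  proof
    fix x assume "x \<in> {x \<in> silent k s. waits x k s}"
    moreover from this have "encrypt (x \<circ> skip k s (k + 2)) = encrypt x"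
      by (intro encrypt_skip) (auto simp: silent_def)
    ultimately show "x \<in> ?E" by (simp add: silent_def waits_def)
  qed
  then have "emeasure cantor_measure {x \<in> silent k s. waits x k s} \<le> emeasure cantor_measure ?E"
    using E by (rule emeasure_mono)
  also have "\<dots> = ennreal (1 / 2 ^ (k + 2)) * emeasure cantor_measure (silent k s)"
    by (rule emeasure_column_start_skip[OF sets_silent])
  finally show ?thesis .
qed

text \<open>
Requirement \<open>k\<close> has at most one last attempt. So the losses at the various stages \<open>s\<close> add up to at most
\<open>2 ^ -(k + 2)\<close>, and the losses over all \<open>k\<close> to at most one half.
\<close>

lemma emeasure_settled: "emeasure cantor_measure settled > 0"
proof -
  let ?L = "\<lambda>k s. {x \<in> silent k s. waits x k s}"
  have L: "?L k s \<in> sets cantor_measure" for k s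
    using sets.Int[OF sets_silent sets_cantor_measure_Collect[OF pred_waits]]
    by (simp add: Collect_conj_eq)
  have "- settled = (\<Union>k. \<Union>s. ?L k s)"
    unfolding settled_def silent_def by auto
  have column: "emeasure cantor_measure (\<Union>s. ?L k s) \<le> ennreal (1 / 2 ^ (k + 2))" for k
  proof -
    have "emeasure cantor_measure (\<Union>s. ?L k s) \<le> (\<Sum>s. emeasure cantor_measure (?L k s))"
      using L by (intro emeasure_subadditive_countably) auto
    also have "\<dots> \<le> (\<Sum>s. ennreal (1 / 2 ^ (k + 2)) * emeasure cantor_measure (silent k s))"
      by (intro suminf_le emeasure_silent_waits) auto
    also have "\<dots> = ennreal (1 / 2 ^ (k + 2)) * (\<Sum>s. emeasure cantor_measure (silent k s))"
      by (rule ennreal_suminf_cmult)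
    also have "(\<Sum>s. emeasure cantor_measure (silent k s)) = emeasure cantor_measure (\<Union>s. silent k s)"
      using sets_silent disjoint_silent by (intro suminf_emeasure) auto
    also have "ennreal (1 / 2 ^ (k + 2)) * \<dots> \<le> ennreal (1 / 2 ^ (k + 2)) * 1"
      using cantor.emeasure_le_1 by (intro mult_left_mono) auto
    finally show ?thesis by simp
  qed
  have "emeasure cantor_measure (- settled) \<le> (\<Sum>k. emeasure cantor_measure (\<Union>s. ?L k s))"
    unfolding \<open>- settled = _\<close> using L by (intro emeasure_subadditive_countably) auto
  also have "\<dots> \<le> (\<Sum>k. ennreal (1 / 2 ^ (k + 2)))"
    by (intro suminf_le column) auto
  also have "\<dots> = ennreal (1 / 2)"
  proof (rule suminf_ennreal_eq)
    have "(\<lambda>k. (1 / 2) ^ k * (1 / 4)) sums (1 / (1 - 1 / 2) * (1 / 4) :: real)"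
      by (intro sums_mult2 geometric_sums) simp
    then show "(\<lambda>k. 1 / 2 ^ (k + 2)) sums (1 / 2 :: real)"
      by (simp add: power_one_over field_simps)
  qed simp
  finally have "cantor.prob (- settled) \<le> 1 / 2"
    unfolding cantor.emeasure_eq_measure by (subst (asm) ennreal_le_iff) simp_all
  then show ?thesis
    using cantor.prob_compl[of settled] sets_settled
    by (simp add: cantor.emeasure_eq_measure Compl_eq_Diff_UNIV)
qed

section \<open>Waiting in some attempt\<close>

text \<open>
Requirement \<open>k\<close> starts an attempt at stage \<open>s\<close> and no earlier attempt had a waiting column.
\<close>

definition first_chance :: "nat \<Rightarrow> nat \<Rightarrow> cantor set" where
  "first_chance k s = {x. starts (encrypt x) k s \<and>
    (\<forall>s'<s. starts (encrypt x) k s' \<longrightarrow> \<not> waits x k s')}"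

lemma sets_first_chance: "first_chance k s \<in> sets cantor_measure"
  unfolding first_chance_def by (rule sets_cantor_measure_Collect) measurable

text \<open>
The event is determined before column \<open>(k, s)\<close> is looked at.
\<close>

lemma first_chance_skip: "x \<circ> skip k s m \<in> first_chance k s \<longleftrightarrow> x \<in> first_chance k s"
proof -
  have skip: "(x \<circ> skip k s m) (cell k' s' i) = x (cell k' s' i)" if "s' < s" for k' s' i
    using that by (simp add: skip_cell)
  have "encrypt (x \<circ> skip k s m) n = encrypt x n" if "n < s" for n
    using skip that by (rule encrypt_local)
  then have "starts (encrypt (x \<circ> skip k s m)) k s' = starts (encrypt x) k s'" if "s' \<le> s" for s'
    using that by (intro starts_cong) simp
  moreover have "waits (x \<circ> skip k s m) k s' = waits x k s'" if "s' < s" for s'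
    using skip[OF that] by (simp add: waits_def)
  ultimately show ?thesis
    unfolding first_chance_def by simp
qed

lemma prob_first_chance_waits:
  "cantor.prob {x \<in> first_chance k s. waits x k s} = 1 / 2 ^ (k + 3) * cantor.prob (first_chance k s)"
proof -
  have "waits x k s \<longleftrightarrow> (\<forall>i<k + 3. x (cell k s i) = (i < k + 2))" for x
    by (auto simp: waits_def less_Suc_eq numeral_3_eq_3)
  then have "{x \<in> first_chance k s. waits x k s} =
      {x. (\<forall>i<k + 3. x (cell k s i) = (i < k + 2)) \<and> x \<circ> skip k s (k + 3) \<in> first_chance k s}"
    unfolding first_chance_skip by blast
  then have "emeasure cantor_measure {x \<in> first_chance k s. waits x k s} =
      ennreal (1 / 2 ^ (k + 3)) * emeasure cantor_measure (first_chance k s)"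
    using emeasure_column_start_skip[OF sets_first_chance] by simp
  then show ?thesis
    by (simp add: cantor.emeasure_eq_measure flip: ennreal_mult)
qed

text \<open>
For distinct \<open>s\<close> the events that \<open>s\<close> is the stage of the first waiting column are disjoint, so their
probabilities are summable, and by independence so are the probabilities of \<open>first_chance k s\<close>, which are
larger by the factor \<open>2 ^ (k + 3)\<close>. The Borel-Cantelli lemma yields that almost surely only finitely many of
the events \<open>first_chance k s\<close> occur, whereas infinitely many attempts without a waiting column would make
infinitely many of them occur.
\<close>

lemma AE_waits:
  "AE x in cantor_measure. \<forall>k. (\<forall>s. starts (encrypt x) k s \<longrightarrow> (\<exists>t. fires (encrypt x) k s t)) \<longrightarrow>
    (\<exists>s. starts (encrypt x) k s \<and> waits x k s)"
  unfolding AE_all_countable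
proof
  fix k
  have sets: "{x \<in> first_chance k s. waits x k s} \<in> sets cantor_measure" for s
    using sets.Int[OF sets_first_chance sets_cantor_measure_Collect[OF pred_waits]]
    by (simp add: Collect_conj_eq)
  have "\<not> (s < s' \<and> x \<in> first_chance k s \<and> waits x k s \<and> x \<in> first_chance k s')" for x s s'
    by (auto simp: first_chance_def)
  then have "s = s'" if "x \<in> first_chance k s" "waits x k s" "x \<in> first_chance k s'" "waits x k s'"
    for x s s'
    using that by (meson linorder_neqE_nat)
  then have "disjoint_family (\<lambda>s. {x \<in> first_chance k s. waits x k s})"
    unfolding disjoint_family_on_def by blast
  with sets have "(\<lambda>s. cantor.prob {x \<in> first_chance k s. waits x k s}) sums
      cantor.prob (\<Union>s. {x \<in> first_chance k s. waits x k s})"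
    by (intro cantor.finite_measure_UNION) auto
  then have "summable (\<lambda>s. 1 / 2 ^ (k + 3) * cantor.prob (first_chance k s))"
    unfolding prob_first_chance_waits by (rule sums_summable)
  then have "summable (\<lambda>s. cantor.prob (first_chance k s))"
    by (subst (asm) summable_cmult_iff) simp
  then have "AE x in cantor_measure. \<forall>\<^sub>F s in sequentially. x \<in> space cantor_measure - first_chance k s"
    by (intro borel_cantelli_AE1 sets_first_chance) (auto simp: cantor.emeasure_eq_measure)
  then show "AE x in cantor_measure.
      (\<forall>s. starts (encrypt x) k s \<longrightarrow> (\<exists>t. fires (encrypt x) k s t)) \<longrightarrow>
      (\<exists>s. starts (encrypt x) k s \<and> waits x k s)"
  proof eventually_elim
    case (elim x)
    then obtain N where N: "\<And>s. N \<le> s \<Longrightarrow> x \<notin> first_chance k s"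
      unfolding eventually_sequentially by auto
    show ?case
    proof (rule impI, rule ccontr)
      assume fires: "\<forall>s. starts (encrypt x) k s \<longrightarrow> (\<exists>t. fires (encrypt x) k s t)"
        and none: "\<not> (\<exists>s. starts (encrypt x) k s \<and> waits x k s)"
      have "\<exists>s\<ge>n. starts (encrypt x) k s" for n
      proof (induction n)
        case 0
        show ?case using starts_0 by blast
      next
        case (Suc n)
        then obtain s where s: "n \<le> s" "starts (encrypt x) k s" by blast
        with fires obtain t where "fires (encrypt x) k s t"
          by (elim allE[of _ s] impE exE)
        with s(2) obtain u where "s \<le> u" "starts (encrypt x) k (Suc u)"
          by (rule next_start)
        with s(1) show ?case
          by (intro exI[of _ "Suc u"]) simp
      qed
      then obtain s where "N \<le> s" "starts (encrypt x) k s" by blast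
      with none have "x \<in> first_chance k s"
        by (auto simp: first_chance_def)
      with N \<open>N \<le> s\<close> show False by blast
    qed
  qed
qed

section \<open>Counting agreeing oracles\<close>

definition hits :: "cantor \<Rightarrow> functional \<Rightarrow> nat \<Rightarrow> bool \<Rightarrow> cantor set" where
  "hits y \<Phi> p b = {r. computes (y \<squnion>\<squnion> r) \<Phi> [p] (of_bool b)}"

lemma measurable_join_right [measurable]:
  "(\<lambda>r. y \<squnion>\<squnion> r) \<in> measurable cantor_measure cantor_measure"
  by (rule measurable_to_cantor) (simp add: join_def)

lemma sets_hits [measurable]: "hits y \<Phi> p b \<in> sets cantor_measure"
  unfolding hits_def
  by (rule sets_cantor_measure_Collect) (rule measurable_compose[OF measurable_join_right pred_computes])

text \<open>
Counting strings of length \<open>t\<close> amounts to measuring the clopen set \<open>seen t\<close> that they cover. These sets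
increase to the set of all \<open>r\<close> in the cylinder for which the program answers with the shown bit. Hence an
attempt fires at some stage exactly if that set fills more than half of the cylinder.
\<close>

context
  fixes y :: cantor and \<Phi> :: functional and a d s k :: nat
  assumes k: "k = prod_encode (program_code \<Phi>, prod_encode (a, d))"
begin

lemma requirement_projections:
  "pfst k = program_code \<Phi>" "pfst (psnd k) = a" "psnd (psnd k) = d"
  by (simp_all add: k)

definition seen :: "nat \<Rightarrow> cantor set" where
  "seen t = {r. prefix_code r t \<in> correct_codes y k s t}"

lemma seen_eq:
  assumes "a \<le> t"
  shows "seen t = {r. prefix_code r a = d \<and>
    (\<exists>c<t. says (y \<squnion>\<squnion> r) (2 * t) c (program_code \<Phi>) (cell k s 0) (y (cell k s 1)))}"
proof -
  have "says (y \<squnion>\<squnion> bit (prefix_code r t)) (2 * t) c e p b = says (y \<squnion>\<squnion> r) (2 * t) c e p b" for r c e p b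
    by (intro says_cong join_cong_less) simp_all
  then show ?thesis
    using assms by (simp add: seen_def correct_codes_def requirement_projections prefix_code_less prefix_code_mod)
qed

lemma prob_seen: "cantor.prob (seen t) = card (correct_codes y k s t) / 2 ^ t"
  unfolding seen_def by (rule prob_prefix_code_card) (auto simp: correct_codes_def)

lemma fires_iff_prob_seen:
  "fires y k s t \<longleftrightarrow> s < t \<and> cell k s 1 < t \<and> a \<le> t \<and> 1 / 2 ^ a < 2 * cantor.prob (seen t)"
proof -
  have "2 ^ t < 2 * 2 ^ a * card (correct_codes y k s t) \<longleftrightarrow>
      (2 ^ t :: real) < 2 * 2 ^ a * card (correct_codes y k s t)"
    by (metis (mono_tags, lifting) of_nat_less_iff of_nat_mult of_nat_numeral of_nat_power)
  also have "\<dots> \<longleftrightarrow> 1 / 2 ^ a < 2 * cantor.prob (seen t)"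
    by (simp add: prob_seen field_simps)
  finally show ?thesis by (simp add: fires_def requirement_projections)
qed

lemma fires_sound:
  assumes "fires y k s t"
  shows "1 / 2 ^ a <
    2 * cantor.prob (hits y \<Phi> (cell k s 0) (y (cell k s 1)) \<inter> {r. prefix_code r a = d})"
proof -
  have t: "a \<le> t" "1 / 2 ^ a < 2 * cantor.prob (seen t)"
    using assms by (simp_all add: fires_iff_prob_seen)
  have "seen t \<subseteq> hits y \<Phi> (cell k s 0) (y (cell k s 1)) \<inter> {r. prefix_code r a = d}"
    unfolding seen_eq[OF t(1)] hits_def computes_iff_says by blast
  then have "cantor.prob (seen t) \<le>
      cantor.prob (hits y \<Phi> (cell k s 0) (y (cell k s 1)) \<inter> {r. prefix_code r a = d})"
    by (intro cantor.finite_measure_mono sets.Int sets_hits sets_cantor_measure_Collect pred_prefix_code)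
  with t(2) show ?thesis by linarith
qed

lemma fires_complete:
  assumes "1 / 2 ^ a <
    2 * cantor.prob (hits y \<Phi> (cell k s 0) (y (cell k s 1)) \<inter> {r. prefix_code r a = d})"
  shows "\<exists>t. fires y k s t"
proof -
  let ?R = "hits y \<Phi> (cell k s 0) (y (cell k s 1)) \<inter> {r. prefix_code r a = d}"
  have "incseq (\<lambda>n. seen (a + n))"
  proof (rule incseq_SucI, rule subsetI)
    fix n r assume "r \<in> seen (a + n)"
    then obtain c where "prefix_code r a = d" "c < a + n"
      "says (y \<squnion>\<squnion> r) (2 * (a + n)) c (program_code \<Phi>) (cell k s 0) (y (cell k s 1))"
      by (auto simp: seen_eq)
    moreover from this(3)
    have "says (y \<squnion>\<squnion> r) (2 * (a + Suc n)) c (program_code \<Phi>) (cell k s 0) (y (cell k s 1))"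
      by (rule says_mono) simp
    ultimately show "r \<in> seen (a + Suc n)"
      unfolding seen_eq[OF le_add1] by (auto intro!: exI[of _ c])
  qed
  moreover have "seen t \<in> sets cantor_measure" for t
    unfolding seen_def by (intro sets_cantor_measure_Collect pred_prefix_code)
  ultimately have "(\<lambda>n. cantor.prob (seen (a + n))) \<longlonglongrightarrow> cantor.prob (\<Union>n. seen (a + n))"
    by (intro cantor.finite_Lim_measure_incseq) auto
  also have "(\<Union>n. seen (a + n)) = ?R"
  proof (rule set_eqI, rule iffI)
    fix r assume "r \<in> (\<Union>n. seen (a + n))"
    then show "r \<in> ?R"
      by (auto simp: seen_eq hits_def computes_iff_says)
  next
    fix r assume r: "r \<in> ?R"
    then obtain u c where
      says: "says (y \<squnion>\<squnion> r) u c (program_code \<Phi>) (cell k s 0) (y (cell k s 1))"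
      unfolding hits_def computes_iff_says by blast
    define t where "t = a + (u + Suc c)"
    have "says (y \<squnion>\<squnion> r) (2 * t) c (program_code \<Phi>) (cell k s 0) (y (cell k s 1))"
      by (rule says_mono[OF says]) (simp add: t_def)
    moreover have "a \<le> t" "c < t" by (simp_all add: t_def)
    ultimately have "r \<in> seen t"
      using r unfolding seen_eq[OF \<open>a \<le> t\<close>] by blast
    then show "r \<in> (\<Union>n. seen (a + n))"
      unfolding t_def by blast
  qed
  finally have "(\<lambda>n. cantor.prob (seen (a + n))) \<longlonglongrightarrow> cantor.prob ?R" .
  moreover have "1 / 2 ^ a / 2 < cantor.prob ?R"
    using assms unfolding divide_less_eq_numeral1 mult.commute[of 2] .
  ultimately have "\<forall>\<^sub>F n in sequentially. 1 / 2 ^ a / 2 < cantor.prob (seen (a + n))"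
    by (rule order_tendstoD)
  then obtain N where N: "\<And>n. N \<le> n \<Longrightarrow> 1 / 2 ^ a / 2 < cantor.prob (seen (a + n))"
    unfolding eventually_sequentially by blast
  have "fires y k s (a + (N + s + cell k s 1 + 1))"
    using N[of "N + s + cell k s 1 + 1"] unfolding fires_iff_prob_seen by simp
  then show ?thesis by blast
qed

end

text \<open>
If the set \<open>S\<close> of successful \<open>r\<close> were not null, it would fill more than half of some cylinder, which
together with \<open>\<Phi>\<close> gives a requirement \<open>k\<close>. If all attempts of \<open>k\<close> fire, one of their columns waits, and the
\<open>r\<close> that answer with its shown first bit are wrong about \<open>x\<close> and also fill more than half of the cylinder.
Otherwise the last attempt is silent, its column does not wait, and all \<open>r\<close> in \<open>S\<close> answer with its shown
first bit, so the attempt fires after all.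
\<close>

lemma prob_inverters:
  fixes x :: cantor and \<Phi> :: functional
  defines "S \<equiv> {r. \<forall>n. computes (encrypt x \<squnion>\<squnion> r) \<Phi> [n] (of_bool (x n))}"
  assumes x: "x \<in> settled"
    and waits: "\<And>k. (\<forall>s. starts (encrypt x) k s \<longrightarrow> (\<exists>t. fires (encrypt x) k s t)) \<Longrightarrow>
      \<exists>s. starts (encrypt x) k s \<and> waits x k s"
  shows "cantor.prob S = 0"
proof (rule ccontr)
  assume pos: "cantor.prob S \<noteq> 0"
  have S_hits: "S = (\<Inter>n. hits (encrypt x) \<Phi> n (x n))"
    unfolding S_def hits_def by (simp only: Collect_all_eq)
  have S: "S \<in> sets cantor_measure"
    unfolding S_hits using sets_hits by (intro sets.countable_INT) auto
  obtain a d where d: "d < 2 ^ a" and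
    dense: "1 / 2 ^ a < 2 * cantor.prob (S \<inter> {r. prefix_code r a = d})"
    using dense_cylinder[OF S] pos by (metis measure_nonneg less_le)
  define k where k: "k = prod_encode (program_code \<Phi>, prod_encode (a, d))"
  let ?y = "encrypt x" and ?Z = "{r. prefix_code r a = d}"
  have Z: "?Z \<in> sets cantor_measure"
    by (intro sets_cantor_measure_Collect pred_prefix_code)
  show False
  proof (cases "\<forall>s. starts ?y k s \<longrightarrow> (\<exists>t. fires ?y k s t)")
    case True
    from waits[OF True] obtain s where s: "starts ?y k s" "waits x k s"
      by (elim exE conjE)
    with True obtain t where "fires ?y k s t"
      by (elim allE[of _ s] impE exE)
    then have dense': "1 / 2 ^ a < 2 * cantor.prob (hits ?y \<Phi> (cell k s 0) (?y (cell k s 1)) \<inter> ?Z)"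
      using fires_sound[OF k] by blast
    have "?y (cell k s 1) \<noteq> x (cell k s 0)"
      using encrypt_cell(2)[of x k s 0] s by (simp add: waits_def)
    then have "computes z \<Phi> [cell k s 0] (of_bool (?y (cell k s 1))) \<Longrightarrow>
        computes z \<Phi> [cell k s 0] (of_bool (x (cell k s 0))) \<Longrightarrow> False" for z
      using computes_unique[of z \<Phi> "[cell k s 0]" "of_bool (?y (cell k s 1))" "of_bool (x (cell k s 0))"]
      by (simp add: of_bool_def split: if_splits)
    then have disj: "(S \<inter> ?Z) \<inter> (hits ?y \<Phi> (cell k s 0) (?y (cell k s 1)) \<inter> ?Z) = {}"
      unfolding S_def hits_def by blast
    have "cantor.prob (S \<inter> ?Z) + cantor.prob (hits ?y \<Phi> (cell k s 0) (?y (cell k s 1)) \<inter> ?Z) =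
        cantor.prob ((S \<inter> ?Z) \<union> (hits ?y \<Phi> (cell k s 0) (?y (cell k s 1)) \<inter> ?Z))"
      using S Z sets_hits disj by (intro cantor.finite_measure_Union[symmetric]) auto
    also have "\<dots> \<le> cantor.prob ?Z"
      using Z by (intro cantor.finite_measure_mono) auto
    also have "\<dots> = 1 / 2 ^ a"
      using d by (rule prob_prefix_code)
    finally show False
      using dense dense' by linarith
  next
    case False
    then obtain s where s: "starts ?y k s" "\<And>t. \<not> fires ?y k s t" by blast
    then have "\<not> waits x k s"
      using x by (auto elim: settledD)
    then have "?y (cell k s 1) = x (cell k s 0)"
      using encrypt_cell(2)[of x k s 0] by simp
    then have "S \<subseteq> hits ?y \<Phi> (cell k s 0) (?y (cell k s 1))"
      unfolding S_hits by auto
    then have "cantor.prob (S \<inter> ?Z) \<le> cantor.prob (hits ?y \<Phi> (cell k s 0) (?y (cell k s 1)) \<inter> ?Z)"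
      using Z sets_hits by (intro cantor.finite_measure_mono) auto
    with dense have "\<exists>t. fires ?y k s t"
      by (intro fires_complete[OF k]) linarith
    with s(2) show False by blast
  qed
qed

section \<open>Left-onewayness\<close>

text \<open>
As \<^const>\<open>encrypt\<close> is injective on the domain, solving the equation means to recover \<open>x\<close> itself.
\<close>

lemma left_oneway_oneway: "left_oneway oneway"
  unfolding left_oneway_def
proof (intro conjI allI impI)
  show "0 < emeasure cantor_measure (dom oneway)"
    using emeasure_settled by simp
next
  fix g assume "partial_computable g"
  then obtain \<Phi> where dom_g: "\<And>x. x \<in> dom g \<longleftrightarrow> (\<forall>n. \<exists>v. computes x \<Phi> [n] v)"
    and val_g: "\<And>x n. x \<in> dom g \<Longrightarrow> computes x \<Phi> [n] (of_bool (the (g x) n))"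
    unfolding partial_computable_def by blast
  have g_iff: "g w = Some x \<longleftrightarrow> (\<forall>n. computes w \<Phi> [n] (of_bool (x n)))" for w x
  proof
    assume "g w = Some x"
    then show "\<forall>n. computes w \<Phi> [n] (of_bool (x n))"
      using val_g[of w] by (auto simp: domI)
  next
    assume *: "\<forall>n. computes w \<Phi> [n] (of_bool (x n))"
    then have "w \<in> dom g" using dom_g by blast
    then obtain z where z: "g w = Some z" by blast
    have "z n = x n" for n
      using computes_unique[OF val_g[OF \<open>w \<in> dom g\<close>, of n]] * z
      by (metis of_bool_eq_iff option.sel)
    then show "g w = Some x" using z by auto
  qed
  have inv_iff: "(\<exists>y z. oneway x = Some y \<and> g (y \<squnion>\<squnion> r) = Some z \<and> oneway z = Some y) \<longleftrightarrow>
      x \<in> settled \<and> (\<forall>n. computes (encrypt x \<squnion>\<squnion> r) \<Phi> [n] (of_bool (x n)))" for x r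
    unfolding g_iff[symmetric] oneway_def
    using inj_on_encrypt by (auto simp: inj_on_def split: if_splits)
  let ?B = "{(x, r). x \<in> settled \<and> (\<forall>n. computes (encrypt x \<squnion>\<squnion> r) \<Phi> [n] (of_bool (x n)))}"
  let ?S = "{x \<squnion>\<squnion> r |x r. \<exists>y z. oneway x = Some y \<and> g (y \<squnion>\<squnion> r) = Some z \<and> oneway z = Some y}"
  have S: "?S = {w. ((\<lambda>n. w (2 * n)), (\<lambda>n. w (2 * n + 1))) \<in> ?B}"
  proof (rule set_eqI, rule iffI)
    fix w assume "w \<in> ?S"
    then obtain x r where "w = x \<squnion>\<squnion> r" "(x, r) \<in> ?B"
      unfolding inv_iff by blast
    then show "w \<in> {w. ((\<lambda>n. w (2 * n)), (\<lambda>n. w (2 * n + 1))) \<in> ?B}"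
      by (simp only: mem_Collect_eq join_even_odd)
  next
    fix w assume "w \<in> {w. ((\<lambda>n. w (2 * n)), (\<lambda>n. w (2 * n + 1))) \<in> ?B}"
    moreover have "w = (\<lambda>n. w (2 * n)) \<squnion>\<squnion> (\<lambda>n. w (2 * n + 1))"
      by (auto simp: join_def fun_eq_iff)
    ultimately show "w \<in> ?S"
      unfolding inv_iff by blast
  qed
  let ?P = "cantor_measure \<Otimes>\<^sub>M cantor_measure"
  interpret pair: pair_prob_space cantor_measure cantor_measure ..
  have B: "?B \<in> sets ?P"
  proof -
    have step: "Measurable.pred ?P (\<lambda>(x, r). computes (encrypt x \<squnion>\<squnion> r) \<Phi> [n] (of_bool b))" for n b
    proof -
      have "(\<lambda>(x, r). encrypt x \<squnion>\<squnion> r) \<in> measurable ?P cantor_measure"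
        using measurable_compose[of "\<lambda>(x, r). (encrypt x, r)" ?P ?P "\<lambda>(x, r). x \<squnion>\<squnion> r" cantor_measure]
        by (simp add: split_beta)
      from measurable_compose[OF this pred_computes] show ?thesis
        by (simp add: split_beta)
    qed
    have "computes w \<Phi> [n] (of_bool (x n)) \<longleftrightarrow>
        (x n \<and> computes w \<Phi> [n] (of_bool True)) \<or> (\<not> x n \<and> computes w \<Phi> [n] (of_bool False))" for w x n
      by (cases "x n") simp_all
    then have "?B = {z \<in> space ?P. fst z \<in> settled \<and> (\<forall>n.
        (fst z n \<and> (case z of (x, r) \<Rightarrow> computes (encrypt x \<squnion>\<squnion> r) \<Phi> [n] (of_bool True))) \<or>
        (\<not> fst z n \<and> (case z of (x, r) \<Rightarrow> computes (encrypt x \<squnion>\<squnion> r) \<Phi> [n] (of_bool False))))}"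
      by (auto simp: space_pair_measure)
    also have "\<dots> \<in> sets ?P"
      using step by measurable
    finally show ?thesis .
  qed
  have S_sets: "?S \<in> sets cantor_measure"
  proof -
    have "(\<lambda>w. ((\<lambda>n. w (2 * n)), (\<lambda>n. w (2 * n + 1)))) \<in> measurable cantor_measure ?P"
      by (intro measurable_Pair measurable_to_cantor) simp_all
    from measurable_sets[OF this B] show ?thesis
      unfolding S by (simp add: vimage_def)
  qed
  have "emeasure cantor_measure ?S = emeasure ?P ((\<lambda>(x, r). x \<squnion>\<squnion> r) -` ?S \<inter> space ?P)"
    using emeasure_distr[OF measurable_join S_sets] unfolding distr_join .
  also have "(\<lambda>(x, r). x \<squnion>\<squnion> r) -` ?S \<inter> space ?P = ?B"
    unfolding S by (auto simp: space_pair_measure join_even_odd join_def)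
  also have "emeasure ?P ?B = (\<integral>\<^sup>+x. emeasure cantor_measure (Pair x -` ?B) \<partial>cantor_measure)"
    by (rule cantor.emeasure_pair_measure_alt[OF B])
  also have "\<dots> = (\<integral>\<^sup>+x. 0 \<partial>cantor_measure)"
  proof (rule nn_integral_cong_AE)
    show "AE x in cantor_measure. emeasure cantor_measure (Pair x -` ?B) = 0"
      using AE_waits
    proof eventually_elim
      case (elim x)
      show ?case
      proof (cases "x \<in> settled")
        case True
        then have "Pair x -` ?B = {r. \<forall>n. computes (encrypt x \<squnion>\<squnion> r) \<Phi> [n] (of_bool (x n))}"
          by auto
        then show ?thesis
          using prob_inverters[OF True, of \<Phi>] elim by (simp add: cantor.emeasure_eq_measure)
      qed (simp add: vimage_def)
    qed
  qed
  finally show "?S \<in> null_sets cantor_measure"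
    using S_sets by (simp add: null_setsI)
qed

theorem theorem4p2:
  "\<exists>f :: cantor \<rightharpoonup> cantor. partial_computable f \<and> inj_on f (dom f) \<and> left_oneway f"
proof (intro exI conjI)
  have "settled \<noteq> {}" using emeasure_settled by auto
  then show "partial_computable oneway" by (rule partial_computable_oneway)
  show "inj_on oneway (dom oneway)"
    using inj_on_encrypt by (simp add: inj_on_def oneway_def)
  show "left_oneway oneway" by (rule left_oneway_oneway)
qed

end
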